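(* Let $0<\alpha\le 1$, $C_0>0$, $0<\varepsilon<1$ and $\varepsilon^2/4\le\gamma<1$, with $x_{\varepsilon,\gamma}\le 1$. There are a constant $C>0$ and a constant $M>0$ depending on $C_0$ such that the following holds for every $f:\mathbb{R}^2\to\mathbb{C}$ with $\|f\|_{C^{0,\alpha}(\mathbb{R}^2)}\le C_0$ and $\operatorname{supp} f\subset\{(x,y): y\ge x^2\}$. If $\|R[f]\|_{\varepsilon,\gamma}$ is sufficiently small, then for a suitable choice of the integer $N\ge1$ the mean $\mathcal{M}_{\varepsilon,\gamma}[f]=\mathcal{M}_{\varphi_N,\varepsilon,\gamma}[f]$ satisfies $$\|\mathcal{M}_{\varepsilon,\gamma}[f]\|_2\le 4M\left(\frac{\log(C/\varepsilon)}{\log\left(M/\|R[f]\|_{\varepsilon,\gamma}\right)}\right)^{\alpha}.$$ (The right-hand side is read as $0$ when $\|R[f]\|_{\varepsilon,\gamma}=0$.)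
   Context: Hölder seminorm: $\|f\|_{C^{0,\alpha}(\mathbb{R}^2)}=\sup_{p\ne q}|f(p)-f(q)|/\|p-q\|^\alpha$. Radon transform: $R[f](\xi,\eta)=\int_{\mathbb{R}}f(x,\xi x+\eta)\,dx$. Test functions: fix a sequence $\varphi_N\in C_0^\infty([-1,1])$, $N=1,2,\dots$, with $\varphi_N\ge0$, $\varphi_N$ even, $\int\varphi_N=1$, and $\|\varphi_N^{(k)}\|_\infty\le C_\ast^{k+1}N^k$ for $k\le N$, where $C_\ast$ does not depend on $N$ or $k$. Means: for a nonnegative even $\varphi\in C_0^\infty([-1,1])$ with $\int\varphi=1$ and $\varphi_{\varepsilon|x|}(t)=\frac1{\varepsilon|x|}\varphi\left(\frac{t}{\varepsilon|x|}\right)$, put $\mathcal{M}_{\varphi,\varepsilon,\gamma}[f](x)=\int f(x,y)\varphi_{\varepsilon|x|}(\gamma-y)\,dy$ for $x\ne0$ and $\mathcal{M}_{\varphi,\varepsilon,\gamma}[f](0)=f(0,\gamma)$. $x_{\varepsilon,\gamma}$ is the positive solution of $x^2=\varepsilon x+\gamma$; the condition $x_{\varepsilon,\gamma}\le1$ guarantees that $\mathcal{M}_{\varepsilon,\gamma}[f]$ is supported in $[-1,1]$. $\|\cdot\|_2$ is the norm of $L^2([-1,1])$. Data norm: $R_{\varepsilon,\gamma}=\{(\xi,\eta):|\xi|\le\varepsilon,|\eta|<\gamma\}$, and $\|\cdot\|_{\varepsilon,\gamma}$ is a fixed family of norms, increasing in $\varepsilon$ and $\gamma$, such that for some absolute constant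 $c>0$, $\|g\|_{\varepsilon,\gamma}\ge c\max\{\|g\|_{L^1(R_{\varepsilon,\gamma})},\|g(\cdot,\gamma)\|_{L^1[-\varepsilon,\varepsilon]}\}$; for example $\|g\|_{\varepsilon,\gamma}=\sup_{|\eta|\le\gamma}\|g(\cdot,\eta)\|_{L^1[-\varepsilon,\varepsilon]}$. "Sufficiently small" means below a positive threshold not depending on $f$. The constant $C$ does not depend on $f$, $\varepsilon$, $\gamma$. *)

theory Defs
  imports "HOL-Analysis.Analysis"
begin

text \<open>Extended-real valued, so that the seminorm of a function that is not Hoelder continuous
  is infinite.  The norm of the product type \<^typ>\<open>real \<times> real\<close> is the Euclidean one.\<close>

definition holder_seminorm :: "real \<Rightarrow> (real \<times> real \<Rightarrow> complex) \<Rightarrow> ereal" where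
  "holder_seminorm \<alpha> f =
     (SUP (p, q) \<in> {(p, q). p \<noteq> q}. ereal (cmod (f p - f q) / norm (p - q) powr \<alpha>))"

definition supp :: "('a::topological_space \<Rightarrow> 'b::zero) \<Rightarrow> 'a set" where
  "supp f = closure {p. f p \<noteq> 0}"

definition radon :: "(real \<times> real \<Rightarrow> complex) \<Rightarrow> real \<times> real \<Rightarrow> complex" where
  "radon f = (\<lambda>(\<xi>, \<eta>). LINT x|lborel. f (x, \<xi> * x + \<eta>))"

definition smooth :: "(real \<Rightarrow> real) \<Rightarrow> bool" where
  "smooth g \<longleftrightarrow> (\<forall>k t. (deriv ^^ k) g differentiable (at t))"

definition mean_kernel :: "(real \<Rightarrow> real) \<Rightarrow> bool" where
  "mean_kernel \<phi> \<longleftrightarrow>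
     smooth \<phi> \<and> supp \<phi> \<subseteq> {-1..1} \<and>
     (\<forall>t. 0 \<le> \<phi> t) \<and> (\<forall>t. \<phi> (- t) = \<phi> t) \<and> (LINT t|lborel. \<phi> t) = 1"

definition test_sequence :: "(nat \<Rightarrow> real \<Rightarrow> real) \<Rightarrow> bool" where
  "test_sequence \<phi> \<longleftrightarrow>
     (\<forall>N\<ge>1. mean_kernel (\<phi> N)) \<and>
     (\<exists>Cs::real. \<forall>N\<ge>1. \<forall>k\<le>N. \<forall>t. \<bar>(deriv ^^ k) (\<phi> N) t\<bar> \<le> Cs ^ (k + 1) * real N ^ k)"

definition dilate :: "(real \<Rightarrow> real) \<Rightarrow> real \<Rightarrow> real \<Rightarrow> real" where
  "dilate \<phi> s t = 1 / s * \<phi> (t / s)"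

definition mean ::
    "(real \<Rightarrow> real) \<Rightarrow> real \<Rightarrow> real \<Rightarrow> (real \<times> real \<Rightarrow> complex) \<Rightarrow> real \<Rightarrow> complex" where
  "mean \<phi> \<epsilon> \<gamma> f x =
     (if x = 0 then f (0, \<gamma>)
      else LINT y|lborel. f (x, y) * complex_of_real (dilate \<phi> (\<epsilon> * \<bar>x\<bar>) (\<gamma> - y)))"

definition x_sol :: "real \<Rightarrow> real \<Rightarrow> real" where
  "x_sol \<epsilon> \<gamma> = (THE x. 0 < x \<and> x\<^sup>2 = \<epsilon> * x + \<gamma>)"

text \<open>Applied below only to means of continuous functions, which are continuous, so the integral
  exists.\<close>

definition L2_norm :: "(real \<Rightarrow> complex) \<Rightarrow> real" where
  "L2_norm g = sqrt (LINT x:{-1..1}|lborel. (cmod (g x))\<^sup>2)"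

definition data_rect :: "real \<Rightarrow> real \<Rightarrow> (real \<times> real) set" where
  "data_rect \<epsilon> \<gamma> = {(\<xi>, \<eta>). \<bar>\<xi>\<bar> \<le> \<epsilon> \<and> \<bar>\<eta>\<bar> < \<gamma>}"

text \<open>
  A data norm may be finite only on a subspace of the continuous functions (a Sobolev norm, say);
  it takes the value \<open>\<infinity>\<close> elsewhere.  Continuous functions on the closed rectangle are represented
  by continuous functions on the plane.  The definiteness clause, with the triangle inequality,
  makes the norm depend only on the restriction to the closed rectangle.  The parameters are kept
  below 1: a constant \<open>c\<close> valid for all \<open>\<gamma>\<close> does not exist for
  \<open>sup {\<parallel>g(\<cdot>,\<eta>)\<parallel> | \<bar>\<eta>\<bar> \<le> \<gamma>}\<close> with the norm of \<open>L\<^sup>1[-\<epsilon>,\<epsilon>]\<close>, which is to be an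
  instance.
\<close>

definition data_norm :: "real \<Rightarrow> real \<Rightarrow> ((real \<times> real \<Rightarrow> complex) \<Rightarrow> ennreal) \<Rightarrow> bool" where
  "data_norm \<epsilon> \<gamma> \<nu> \<longleftrightarrow>
     (\<forall>g h. continuous_on UNIV g \<longrightarrow> continuous_on UNIV h \<longrightarrow>
        \<nu> (\<lambda>p. g p + h p) \<le> \<nu> g + \<nu> h) \<and>
     (\<forall>a g. continuous_on UNIV g \<longrightarrow> \<nu> (\<lambda>p. a * g p) = ennreal (cmod a) * \<nu> g) \<and>
     (\<forall>g. continuous_on UNIV g \<longrightarrow>
        (\<nu> g = 0 \<longleftrightarrow> (\<forall>p \<in> {-\<epsilon>..\<epsilon>} \<times> {-\<gamma>..\<gamma>}. g p = 0)))"

definition data_norm_family ::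
    "(real \<Rightarrow> real \<Rightarrow> (real \<times> real \<Rightarrow> complex) \<Rightarrow> ennreal) \<Rightarrow> bool" where
  "data_norm_family \<nu> \<longleftrightarrow>
     (\<forall>\<epsilon> \<gamma>. 0 < \<epsilon> \<longrightarrow> \<epsilon> < 1 \<longrightarrow> 0 < \<gamma> \<longrightarrow> \<gamma> < 1 \<longrightarrow> data_norm \<epsilon> \<gamma> (\<nu> \<epsilon> \<gamma>)) \<and>
     (\<forall>\<epsilon> \<epsilon>' \<gamma> \<gamma>' g. 0 < \<epsilon> \<longrightarrow> \<epsilon> \<le> \<epsilon>' \<longrightarrow> \<epsilon>' < 1 \<longrightarrow> 0 < \<gamma> \<longrightarrow> \<gamma> \<le> \<gamma>' \<longrightarrow> \<gamma>' < 1 \<longrightarrow>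
        continuous_on UNIV g \<longrightarrow> \<nu> \<epsilon> \<gamma> g \<le> \<nu> \<epsilon>' \<gamma>' g) \<and>
     (\<exists>c>0. \<forall>\<epsilon> \<gamma> g. 0 < \<epsilon> \<longrightarrow> \<epsilon> < 1 \<longrightarrow> 0 < \<gamma> \<longrightarrow> \<gamma> < 1 \<longrightarrow> continuous_on UNIV g \<longrightarrow>
        \<nu> \<epsilon> \<gamma> g \<ge> ennreal c *
          max (\<integral>\<^sup>+p \<in> data_rect \<epsilon> \<gamma>. ennreal (cmod (g p)) \<partial>lborel)
              (\<integral>\<^sup>+\<xi> \<in> {-\<epsilon>..\<epsilon>}. ennreal (cmod (g (\<xi>, \<gamma>))) \<partial>lborel))"

end

theory Submission
  imports Defs "HOL-Computational_Algebra.Polynomial" "HOL-Real_Asymp.Real_Asymp"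
begin

text \<open>
  After the substitution \<open>y = \<gamma> + \<xi> x\<close> the mean \<open>h\<close> becomes an average of the values of \<open>f\<close> along lines of
  slope \<open>\<xi>\<close> through the point \<open>(0, \<gamma>)\<close>:
  \<open>h(x) = \<integral> f(x, \<gamma> + \<xi> x) \<phi>(\<xi>/\<epsilon>)/\<epsilon> d\<xi>\<close>, with \<open>|\<xi>| \<le> \<epsilon>\<close>.  The condition on \<open>x_sol\<close> amounts to
  \<open>\<epsilon> + \<gamma> \<le> 1\<close>, and then all these lines lie under the parabola when \<open>|x| > 1\<close>; so \<open>h\<close> is a Hoelder
  function supported in \<open>[-1, 1]\<close>.

  The data control the moments of \<open>h\<close>.  Formally
  \<open>x \<partial>\<^sub>\<eta> f(x, \<eta> + \<xi> x) = \<partial>\<^sub>\<xi> f(x, \<eta> + \<xi> x)\<close>, so one factor \<open>x\<close> in a moment can be traded for one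
  derivative of the weight in \<open>\<xi>\<close> and one integration in the height \<open>\<eta>\<close> (\<open>line_moment_Suc\<close>).
  The integration starts at \<open>\<eta> = -\<gamma>\<close>, where by \<open>\<epsilon>\<^sup>2/4 \<le> \<gamma>\<close> the lines miss the interior of the
  parabola and no boundary term appears.  After \<open>k\<close> steps the \<open>k\<close>-th moment is bounded by
  \<open>\<parallel>\<phi>\<^sup>(\<^sup>k\<^sup>)\<parallel> \<epsilon>\<^sup>-\<^sup>k\<^sup>-\<^sup>1 (2\<gamma>)\<^sup>k\<^sup>-\<^sup>1/(k-1)!\<close> times the \<open>L\<^sup>1\<close> norm of the Radon transform \<open>R[f]\<close>
  on the data rectangle (\<open>line_moment_le\<close>, \<open>mean_moment_le\<close>); the zeroth moment only uses \<open>R[f](\<cdot>, \<gamma>)\<close>.  For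
  \<open>\<phi> = \<phi>\<^sub>N\<close> and \<open>k \<le> N\<close> the growth \<open>N\<^sup>k\<close> of the derivatives is absorbed by the factorial, and
  all moments up to \<open>N\<close> are at most \<open>(const/\<epsilon>)\<^sup>N\<^sup>+\<^sup>1 \<delta>\<close>.

  Conversely, the moments of order at most \<open>8n\<close> determine a Hoelder function supported in \<open>[-1, 1]\<close> up to
  \<open>O(n\<^sup>-\<^sup>\<alpha>)\<close>, uniformly in \<open>x\<close> (\<open>holder_bound_by_moments\<close>).  Convolve \<open>h\<close> with an
  algebraic Jackson kernel, a polynomial \<open>J\<^sub>n\<close> of degree \<open>8n\<close> that is concentrated at the scale \<open>1/n\<close>.  The
  convolution differs from \<open>h\<close> by \<open>O(n\<^sup>-\<^sup>\<alpha>)\<close>, and it is a combination of moments whose coefficients grow only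
  exponentially in \<open>n\<close>.

  Hence \<open>|h| \<le> K n\<^sup>-\<^sup>\<alpha> + (\<delta>/c) (E/\<epsilon>)\<^sup>8\<^sup>n\<^sup>+\<^sup>1\<close> for \<open>N = 8n\<close>, where \<open>\<delta>\<close> is the data norm of \<open>R[f]\<close> and \<open>c\<close> the
  constant with which the data norms dominate the \<open>L\<^sup>1\<close> norms, and the logarithmic rate results from choosing \<open>n\<close> as a small
  multiple of \<open>ln (M/\<delta>) / ln (E/\<epsilon>)\<close> (\<open>optimal_degree\<close>).  If \<open>\<delta> = 0\<close>, all moments of \<open>h\<close> vanish
  for the fixed kernel \<open>\<phi>\<^sub>1\<close>, and \<open>n \<longrightarrow> \<infinity>\<close> gives \<open>h = 0\<close>.
\<close>

section \<open>An algebraic Jackson kernel\<close>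

text \<open>Up to sign this is \<open>T\<^sub>2\<^sub>n\<^sub>+\<^sub>1(u) / u\<close> with the Chebyshev polynomial \<open>T\<^sub>2\<^sub>n\<^sub>+\<^sub>1\<close>, that is the Dirichlet
  kernel \<open>sin ((2n+1)t) / sin t\<close> in the variable \<open>u = sin t\<close>.  The recursion comes from
  \<open>sin (a + 2t) + sin (a - 2t) = 2 cos (2t) sin a\<close> with \<open>cos (2t) = 1 - 2u\<^sup>2\<close>; it keeps the growth of the
  coefficients visible.\<close>

fun cheb_quot :: "nat \<Rightarrow> real poly" where
  "cheb_quot 0 = 1"
| "cheb_quot (Suc 0) = [:3, 0, -4:]"
| "cheb_quot (Suc (Suc n)) = [:2, 0, -4:] * cheb_quot (Suc n) - cheb_quot n"

lemma cheb_quot_sin: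
  "poly (cheb_quot n) (sin t) * sin t = sin (real (2 * n + 1) * t)"
proof (induction n rule: cheb_quot.induct)
  case 2
  have "sin (3 * t) = sin (2 * t + t)" by simp
  also have "\<dots> = 3 * sin t - 4 * sin t ^ 3"
    unfolding sin_add sin_double cos_double_sin
    using sin_cos_squared_add[of t] by algebra
  finally show ?case by (simp add: algebra_simps power3_eq_cube)
next
  case (3 n)
  define a where "a = real (2 * Suc n + 1) * t"
  have *: "sin (a + 2 * t) + sin (a - 2 * t) = (2 - 4 * (sin t)\<^sup>2) * sin a"
  proof -
    have "sin (a + 2 * t) + sin (a - 2 * t) = 2 * cos (2 * t) * sin a"
      by (simp add: sin_add sin_diff)
    then show ?thesis by (simp only: cos_double_sin) (simp add: algebra_simps)
  qed
  have e: "real (2 * Suc (Suc n) + 1) * t = a + 2 * t" "real (2 * n + 1) * t = a - 2 * t"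
    by (simp_all add: a_def algebra_simps)
  have "poly (cheb_quot (Suc (Suc n))) (sin t) * sin t
      = (2 - 4 * (sin t)\<^sup>2) * (poly (cheb_quot (Suc n)) (sin t) * sin t) - poly (cheb_quot n) (sin t) * sin t"
    by (simp add: algebra_simps power2_eq_square)
  also have "\<dots> = sin (a + 2 * t)"
    using * 3 unfolding e a_def[symmetric] by simp
  finally show ?case unfolding e .
qed auto

text \<open>The \<open>\<ell>\<^sup>1\<close> norm of the coefficients measures how a bound for moments becomes a bound for integrals against
  a polynomial.  It is submultiplicative.\<close>

definition coeff_norm :: "real poly \<Rightarrow> real" where
  "coeff_norm p = (\<Sum>i\<le>degree p. \<bar>coeff p i\<bar>)"

lemma coeff_norm_0 [simp]: "coeff_norm 0 = 0" by (simp add: coeff_norm_def)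

lemma coeff_norm_pCons [simp]: "coeff_norm (pCons a p) = \<bar>a\<bar> + coeff_norm p"
  by (cases "p = 0") (simp_all add: coeff_norm_def sum.atMost_Suc_shift del: sum.atMost_Suc)

lemma coeff_norm_nonneg [simp]: "0 \<le> coeff_norm p"
  by (simp add: coeff_norm_def sum_nonneg)

lemma coeff_norm_add: "coeff_norm (p + q) \<le> coeff_norm p + coeff_norm q"
proof (induction p q rule: poly_induct2)
  case (pCons a p b q)
  then show ?case using abs_triangle_ineq[of a b] by simp
qed simp

lemma coeff_norm_smult: "coeff_norm (smult c p) = \<bar>c\<bar> * coeff_norm p"
  by (induction p) (auto simp: abs_mult algebra_simps)

lemma coeff_norm_diff: "coeff_norm (p - q) \<le> coeff_norm p + coeff_norm q"
  using coeff_norm_add[of p "smult (-1) q"] by (simp add: coeff_norm_smult[of "-1", simplified])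

lemma coeff_norm_mult: "coeff_norm (p * q) \<le> coeff_norm p * coeff_norm q"
proof (induction p)
  case (pCons a p)
  have "coeff_norm (pCons a p * q) \<le> coeff_norm (smult a q) + coeff_norm (pCons 0 (p * q))"
    by (simp only: mult_pCons_left coeff_norm_add)
  also have "\<dots> \<le> \<bar>a\<bar> * coeff_norm q + coeff_norm p * coeff_norm q"
    using pCons by (simp add: coeff_norm_smult)
  finally show ?case by (simp add: algebra_simps)
qed simp

lemma coeff_norm_power: "coeff_norm (p ^ k) \<le> coeff_norm p ^ k"
proof (induction k)
  case 0
  then show ?case by (simp add: one_pCons)
next
  case (Suc k)
  then show ?case
    using coeff_norm_mult[of p "p ^ k"] mult_left_mono[OF Suc coeff_norm_nonneg[of p]] by simp
qed

text \<open>Applied with \<open>q(y) = (x - y)/2\<close>, whose norm is at most \<open>1\<close> exactly when \<open>|x| \<le> 1\<close>.\<close>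

lemma coeff_norm_pcompose:
  assumes "coeff_norm q \<le> 1"
  shows "coeff_norm (pcompose p q) \<le> coeff_norm p"
proof (induction p)
  case (pCons a p)
  have "coeff_norm (pcompose (pCons a p) q) \<le> \<bar>a\<bar> + coeff_norm q * coeff_norm (pcompose p q)"
    using coeff_norm_add[of "[:a:]" "q * pcompose p q"] coeff_norm_mult[of q "pcompose p q"]
    by (simp add: pcompose_pCons)
  also have "\<dots> \<le> \<bar>a\<bar> + 1 * coeff_norm p"
    using assms pCons by (intro add_left_mono mult_mono) auto
  finally show ?case by simp
qed simp

lemma cheb_quot_degree: "degree (cheb_quot n) \<le> 2 * n"
proof (induction n rule: cheb_quot.induct)
  case (3 n)
  have "degree ([:2, 0, -4:] * cheb_quot (Suc n)) \<le> 2 * Suc (Suc n)"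
    using degree_mult_le[of "[:2, 0, -4:]" "cheb_quot (Suc n)"] 3 by simp
  then show ?case using 3 by (simp only: cheb_quot.simps) (intro degree_diff_le, auto)
qed auto

lemma cheb_quot_coeff_norm: "coeff_norm (cheb_quot n) \<le> 7 ^ n"
proof (induction n rule: cheb_quot.induct)
  case (3 n)
  have "coeff_norm (cheb_quot (Suc (Suc n)))
      \<le> coeff_norm [:2, 0, -4:] * coeff_norm (cheb_quot (Suc n)) + coeff_norm (cheb_quot n)"
    using coeff_norm_diff[of "[:2, 0, -4:] * cheb_quot (Suc n)" "cheb_quot n"]
      coeff_norm_mult[of "[:2, 0, -4:]" "cheb_quot (Suc n)"] by (simp only: cheb_quot.simps)
  also have "\<dots> \<le> 6 * 7 ^ Suc n + 7 ^ n" using 3 by simp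
  also have "\<dots> \<le> 7 ^ Suc (Suc n)" by simp
  finally show ?case .
qed (simp_all add: one_pCons)

lemma abs_sin_mult_le: "\<bar>sin (real k * t)\<bar> \<le> real k * \<bar>sin t\<bar>"
proof (induction k)
  case (Suc k)
  have "\<bar>sin (real (Suc k) * t)\<bar> \<le> \<bar>sin (real k * t) * cos t\<bar> + \<bar>cos (real k * t) * sin t\<bar>"
    by (simp add: algebra_simps sin_add abs_triangle_ineq)
  also have "\<dots> \<le> \<bar>sin (real k * t)\<bar> * 1 + 1 * \<bar>sin t\<bar>"
    unfolding abs_mult by (intro add_mono mult_mono) auto
  also have "\<dots> \<le> real (Suc k) * \<bar>sin t\<bar>" using Suc by (simp add: algebra_simps)
  finally show ?case .
qed simp

lemma cheb_quot_decay:
  assumes "\<bar>u\<bar> \<le> 1"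
  shows "\<bar>u * poly (cheb_quot n) u\<bar> \<le> 1"
proof -
  have "sin (arcsin u) = u" using assms by simp
  with cheb_quot_sin[of n "arcsin u"] have "u * poly (cheb_quot n) u = sin (real (2 * n + 1) * arcsin u)"
    by (simp add: mult.commute)
  then show ?thesis by simp
qed

lemma cheb_quot_at_0: "poly (cheb_quot n) 0 = real (2 * n + 1)"
  by (induction n rule: cheb_quot.induct) (auto simp: algebra_simps)

lemma cheb_quot_bound:
  assumes "\<bar>u\<bar> \<le> 1"
  shows "\<bar>poly (cheb_quot n) u\<bar> \<le> real (2 * n + 1)"
proof (cases "u = 0")
  case False
  have "sin (arcsin u) = u" using assms by simp
  with cheb_quot_sin[of n "arcsin u"] abs_sin_mult_le[of "2 * n + 1" "arcsin u"]
  have "\<bar>poly (cheb_quot n) u\<bar> * \<bar>u\<bar> \<le> real (2 * n + 1) * \<bar>u\<bar>"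
    by (simp flip: abs_mult)
  then show ?thesis using False by simp
qed (simp add: cheb_quot_at_0)

lemma sin_ge_half:
  fixes s :: real
  assumes "0 \<le> s" "s \<le> 1"
  shows "s / 2 \<le> sin s"
proof (cases "s = 0")
  case False
  then obtain z where z: "0 < z" "z < s" "sin s - sin 0 = (s - 0) * cos z"
    using MVT2[of 0 s sin cos] assms by (auto intro: DERIV_sin)
  have "cos (pi / 3) \<le> cos z"
    using z assms pi_gt3 by (intro cos_monotone_0_pi_le) auto
  then have "1 / 2 \<le> cos z" by (simp add: cos_60)
  then have "s * (1 / 2) \<le> s * cos z" using assms by (intro mult_left_mono) auto
  then show ?thesis using z by simp
qed simp

text \<open>With \<open>u = sin t\<close> and \<open>m = 2n+1\<close>, the range of \<open>u\<close> keeps \<open>m t\<close> in \<open>[0, 1]\<close>, where the sine is at least half of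
  its argument.\<close>

lemma cheb_quot_lower:
  assumes "0 \<le> u" "u \<le> 1 / (2 * real (2 * n + 1))"
  shows "poly (cheb_quot n) u \<ge> real (2 * n + 1) / 2"
proof (cases "u = 0")
  case False
  define m where "m = real (2 * n + 1)"
  define t where "t = arcsin u"
  have m: "m \<ge> 1" by (simp add: m_def)
  have u: "0 < u" "u \<le> 1" "u \<le> (1 / m) / 2"
  proof -
    show "0 < u" using assms False by simp
    show "u \<le> (1 / m) / 2" using assms by (simp add: m_def field_simps)
    moreover have "(1 / m) / 2 \<le> 1" using m by (simp add: field_simps)
    ultimately show "u \<le> 1" by (rule order_trans)
  qed
  have st: "sin t = u" using u by (simp add: t_def)
  have t: "0 \<le> t" "t \<le> 1 / m"
  proof -
    have "arcsin u \<le> arcsin (sin (1 / m))"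
      using u sin_ge_half[of "1 / m"] m by (intro arcsin_le_arcsin) auto
    also have "\<dots> = 1 / m"
    proof (rule arcsin_sin)
      have "0 \<le> 1 / m" "1 / m \<le> 1" using m by auto
      then show "- (pi / 2) \<le> 1 / m" "1 / m \<le> pi / 2" using pi_gt3 by linarith+
    qed
    finally show "t \<le> 1 / m" by (simp add: t_def)
    show "0 \<le> t" unfolding t_def using u by (intro arcsin_nonneg) auto
  qed
  have "m / 2 * u \<le> m / 2 * t"
    using m abs_sin_x_le_abs_x[of t] t st u by (intro mult_left_mono) auto
  also have "\<dots> \<le> sin (m * t)" using sin_ge_half[of "m * t"] t m by (simp add: field_simps)
  also have "\<dots> = poly (cheb_quot n) u * u"
    using cheb_quot_sin[of n t] by (simp add: st m_def)
  finally show ?thesis using u by (simp add: m_def)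
qed (simp add: cheb_quot_at_0)

text \<open>The fourth power makes the kernel nonnegative and decay like \<open>u\<^sup>-\<^sup>4\<close>, fast enough for a first moment
  of the order of the mass divided by \<open>n\<close>.  This works for all Hoelder exponents up to \<open>1\<close> inclusive.\<close>

definition jackson :: "nat \<Rightarrow> real poly" where "jackson n = cheb_quot n ^ 4"

lemma jackson_nonneg: "0 \<le> poly (jackson n) u"
  by (simp add: jackson_def poly_power)

lemma jackson_degree: "degree (jackson n) \<le> 8 * n"
  using degree_power_le[of "cheb_quot n" 4] cheb_quot_degree[of n] by (simp add: jackson_def)

lemma jackson_coeff_norm: "coeff_norm (jackson n) \<le> 7 ^ (4 * n)"
proof -
  have "coeff_norm (jackson n) \<le> (7 ^ n) ^ 4"
    unfolding jackson_def
    by (rule order_trans[OF coeff_norm_power]) (intro power_mono cheb_quot_coeff_norm coeff_norm_nonneg)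
  then show ?thesis by (simp add: power_mult mult.commute flip: power_mult)
qed

text \<open>The interval \<open>[0, 1/(2m)]\<close> alone, on which the kernel is at least \<open>(m/2)\<^sup>4\<close>, contributes this much.\<close>

lemma jackson_mass:
  "integral {-1..1} (poly (jackson n)) \<ge> real (2 * n + 1) ^ 3 / 32"
proof -
  define m where "m = real (2 * n + 1)"
  have m: "m \<ge> 1" by (simp add: m_def)
  have "m ^ 3 / 32 = integral {0..1 / (2 * m)} (\<lambda>_. (m / 2) ^ 4)"
    using m by (simp add: field_simps power_def numeral_eq_Suc)
  also have "\<dots> \<le> integral {0..1 / (2 * m)} (poly (jackson n))"
  proof (intro integral_le)
    fix u assume u: "u \<in> {0..1 / (2 * m)}"
    show "(m / 2) ^ 4 \<le> poly (jackson n) u"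
      unfolding jackson_def poly_power using cheb_quot_lower[of u n] u m
      by (intro power_mono) (auto simp: m_def)
  qed (auto intro!: integrable_continuous_interval continuous_intros)
  also have "\<dots> \<le> integral {-1..1} (poly (jackson n))"
    using m by (intro integral_subset_le)
      (auto intro!: integrable_continuous_interval continuous_intros jackson_nonneg simp: field_simps)
  finally show ?thesis by (simp add: m_def)
qed

text \<open>For \<open>q = |cheb_quot n u|\<close> both \<open>q \<le> m\<close> and \<open>|u| q \<le> 1\<close> hold.  Together they give
  \<open>|u| q\<^sup>4 (1 + m\<^sup>2u\<^sup>2) \<le> 2m\<^sup>3\<close>, a majorant that can be integrated in closed form.\<close>

lemma jackson_first_moment:
  "integral {-1..1} (\<lambda>u. \<bar>u\<bar> * poly (jackson n) u) \<le> 2 * pi * real (2 * n + 1) ^ 2"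
proof -
  define m where "m = real (2 * n + 1)"
  have m: "m \<ge> 1" by (simp add: m_def)
  have pos: "1 + (m * u)\<^sup>2 > 0" for u by (simp add: add_pos_nonneg)
  have I: "((\<lambda>u. 2 * m ^ 3 / (1 + (m * u)\<^sup>2)) has_integral
      (2 * m\<^sup>2 * arctan (m * 1) - 2 * m\<^sup>2 * arctan (m * (-1)))) {-1..1}"
  proof (rule fundamental_theorem_of_calculus)
    fix u :: real
    show "((\<lambda>u. 2 * m\<^sup>2 * arctan (m * u)) has_vector_derivative 2 * m ^ 3 / (1 + (m * u)\<^sup>2))
        (at u within {-1..1})"
      unfolding has_real_derivative_iff_has_vector_derivative[symmetric]
      using pos[of u]
      by (auto intro!: derivative_eq_intros simp: field_simps power2_eq_square power3_eq_cube)
  qed simp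
  have "integral {-1..1} (\<lambda>u. \<bar>u\<bar> * poly (jackson n) u)
      \<le> integral {-1..1} (\<lambda>u. 2 * m ^ 3 / (1 + (m * u)\<^sup>2))"
  proof (intro integral_le)
    fix u :: real assume "u \<in> {-1..1}"
    then have u: "\<bar>u\<bar> \<le> 1" by auto
    define q where "q = \<bar>poly (cheb_quot n) u\<bar>"
    have q: "0 \<le> q" "q \<le> m" "\<bar>u\<bar> * q \<le> 1"
      using cheb_quot_bound[OF u, of n] cheb_quot_decay[OF u, of n] by (auto simp: q_def m_def abs_mult)
    have J: "poly (jackson n) u = q ^ 4" by (simp add: jackson_def poly_power q_def)
    have "\<bar>u\<bar> * q ^ 4 * (1 + (m * u)\<^sup>2) = (\<bar>u\<bar> * q) * q ^ 3 + m\<^sup>2 * ((\<bar>u\<bar> * q) ^ 3 * q)"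
      by (simp add: algebra_simps power_def numeral_eq_Suc flip: abs_mult) 
    also have "\<dots> \<le> 1 * m ^ 3 + m\<^sup>2 * (1 ^ 3 * m)"
      using q m by (intro add_mono mult_mono mult_left_mono power_mono) auto
    finally show "\<bar>u\<bar> * poly (jackson n) u \<le> 2 * m ^ 3 / (1 + (m * u)\<^sup>2)"
      unfolding J using pos[of u] by (simp add: pos_le_divide_eq power2_eq_square power3_eq_cube)
  next
    show "(\<lambda>u. 2 * m ^ 3 / (1 + (m * u)\<^sup>2)) integrable_on {-1..1}"
      using I by blast
  qed (auto intro!: integrable_continuous_interval continuous_intros)
  also have "\<dots> = 4 * m\<^sup>2 * arctan m" using integral_unique[OF I] by (simp add: arctan_minus)
  also have "\<dots> \<le> 4 * m\<^sup>2 * (pi / 2)"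
    using arctan_ubound[of m] by (intro mult_left_mono) auto
  finally show ?thesis by (simp add: m_def)
qed

section \<open>Hoelder functions with small moments are small\<close>

lemma integral_poly_le_coeff_norm:
  fixes h :: "real \<Rightarrow> complex"
  assumes cont: "continuous_on {-1..1} h"
    and mom: "\<And>k. k \<le> degree p \<Longrightarrow> cmod (integral {-1..1} (\<lambda>x. x ^ k *\<^sub>R h x)) \<le> B"
  shows "cmod (integral {-1..1} (\<lambda>x. poly p x *\<^sub>R h x)) \<le> coeff_norm p * B"
proof -
  have "integral {-1..1} (\<lambda>x. poly p x *\<^sub>R h x)
      = integral {-1..1} (\<lambda>x. \<Sum>i\<le>degree p. coeff p i *\<^sub>R (x ^ i *\<^sub>R h x))"
    by (simp add: poly_altdef scaleR_sum_left)
  also have "\<dots> = (\<Sum>i\<le>degree p. coeff p i *\<^sub>R integral {-1..1} (\<lambda>x. x ^ i *\<^sub>R h x))"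
    by (subst integral_sum)
      (auto intro!: integrable_continuous_interval continuous_intros cont simp del: scaleR_scaleR)
  also have "cmod \<dots> \<le> (\<Sum>i\<le>degree p. \<bar>coeff p i\<bar> * B)"
    by (rule sum_norm_le) (auto intro!: mult_left_mono mom)
  finally show ?thesis by (simp add: coeff_norm_def sum_distrib_right)
qed

text \<open>Substitute \<open>y = x - 2u\<close>.  The factor \<open>2\<close> makes the range \<open>[x - 2, x + 2]\<close> of \<open>y\<close> cover the support of \<open>h\<close> for
  every \<open>x\<close> in \<open>[-1, 1]\<close>, while the kernel is only evaluated on \<open>[-1, 1]\<close>, where its bounds hold.\<close>

lemma integral_polynomial_convolution:
  fixes h :: "real \<Rightarrow> complex"
  assumes cont: "continuous_on UNIV h" and supp: "\<And>x. \<bar>x\<bar> > 1 \<Longrightarrow> h x = 0" and x: "\<bar>x\<bar> \<le> 1"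
  shows "integral {-1..1} (\<lambda>u. poly p u *\<^sub>R h (x - 2 * u))
       = integral {-1..1} (\<lambda>y. poly (pcompose p [:x / 2, - 1 / 2:]) y *\<^sub>R h y) / 2"
proof -
  define g where "g y = poly (pcompose p [:x / 2, - 1 / 2:]) y *\<^sub>R h y" for y
  have "continuous_on {-1..1} g" unfolding g_def
    by (intro continuous_intros continuous_on_subset[OF cont]) auto
  then have "(g has_integral integral {-1..1} g) {-1..1}"
    by (intro integrable_integral integrable_continuous_interval)
  moreover have "g y = 0" if "y \<notin> {-1..1}" for y
    using that supp[of y] by (auto simp: g_def)
  moreover have "{-1..1} \<subseteq> {x - 2..x + 2}" using x by auto
  ultimately have "(g has_integral integral {-1..1} g) (cbox (x - 2) (x + 2))"
    by (metis box_real(2) has_integral_on_superset)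
  from has_integral_affinity[OF this, of "-2" x]
  have "((\<lambda>u. g (- (2 * u) + x)) has_integral (1 / 2) *\<^sub>R integral {-1..1} g)
      ((\<lambda>u. - (1 / 2) * u + (1 / 2) * x) ` {x - 2..x + 2})"
    by (simp add: scaleR_conv_of_real)
  also have "(\<lambda>u. - (1 / 2) * u + (1 / 2) * x) ` {x - 2..x + 2} = {-1..1}"
    by (subst image_affinity_atLeastAtMost) (auto simp: field_simps)
  also have "(\<lambda>u. g (- (2 * u) + x)) = (\<lambda>u. poly p u *\<^sub>R h (x - 2 * u))"
    by (simp add: g_def poly_pcompose field_simps)
  finally show ?thesis
    by (simp add: integral_unique g_def scaleR_conv_of_real)
qed

text \<open>With the Jackson kernel \<open>K\<close> and its mass \<open>I\<close>, split
  \<open>I h(x) = \<integral> K(u) (h(x) - h(x - 2u)) du + \<integral> K(u) h(x - 2u) du\<close>.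
  The first integral is controlled by the first moment of \<open>K\<close>, the second one by the moments of \<open>h\<close>.\<close>

lemma holder_bound_by_moments:
  fixes h :: "real \<Rightarrow> complex"
  assumes cont: "continuous_on UNIV h" and supp: "\<And>x. \<bar>x\<bar> > 1 \<Longrightarrow> h x = 0"
    and holder: "\<And>x y. cmod (h x - h y) \<le> A * \<bar>x - y\<bar> powr \<alpha>"
    and \<alpha>: "0 < \<alpha>" "\<alpha> \<le> 1" and n: "n \<ge> 1"
    and mom: "\<And>k. k \<le> 8 * n \<Longrightarrow> cmod (integral {-1..1} (\<lambda>x. x ^ k *\<^sub>R h x)) \<le> B"
    and x: "\<bar>x\<bar> \<le> 1"
  shows "cmod (h x) \<le> 258 * A * real n powr (- \<alpha>) + 16 * 7 ^ (4 * n) * B"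
proof -
  define K where "K = poly (jackson n)"
  define I where "I = integral {-1..1} K"
  define m where "m = real (2 * n + 1)"
  define q where "q = pcompose (jackson n) [:x / 2, - 1 / 2:]"
  have contK: "continuous_on S K" for S by (auto simp: K_def intro!: continuous_intros)
  have conth: "continuous_on S (\<lambda>u. h (x - 2 * u))" for S
    by (intro continuous_on_compose2[OF cont] continuous_intros) auto
  have K0: "0 \<le> K u" for u by (simp add: K_def jackson_nonneg)
  have A: "0 \<le> A" using order_trans[OF norm_ge_zero holder[of 1 0]] by simp
  have B: "0 \<le> B" using order_trans[OF norm_ge_zero mom[of 0]] by simp
  have m: "m \<ge> 1" "real n \<le> m / 2" by (auto simp: m_def)
  have I: "I \<ge> m ^ 3 / 32" using jackson_mass[of n] by (simp add: I_def m_def K_def)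
  have I32: "I \<ge> 1 / 32" using I one_le_power[OF m(1), of 3] by simp

  have "cmod (integral {-1..1} (\<lambda>y. poly q y *\<^sub>R h y)) \<le> coeff_norm q * B"
  proof (rule integral_poly_le_coeff_norm)
    show "continuous_on {-1..1} h" by (rule continuous_on_subset[OF cont]) auto
    fix k assume "k \<le> degree q"
    also have "degree q \<le> degree (jackson n)" unfolding q_def degree_pcompose by simp
    also have "\<dots> \<le> 8 * n" by (rule jackson_degree)
    finally show "cmod (integral {-1..1} (\<lambda>x. x ^ k *\<^sub>R h x)) \<le> B" by (rule mom)
  qed
  also have "coeff_norm q * B \<le> 7 ^ (4 * n) * B"
  proof -
    have "coeff_norm q \<le> coeff_norm (jackson n)"
      unfolding q_def using x by (intro coeff_norm_pcompose) simp
    then show ?thesis using jackson_coeff_norm[of n] B by (intro mult_right_mono) auto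
  qed
  finally have conv: "cmod (integral {-1..1} (\<lambda>u. K u *\<^sub>R h (x - 2 * u))) \<le> 7 ^ (4 * n) * B / 2"
    unfolding K_def q_def by (subst integral_polynomial_convolution[OF cont supp x]) (simp_all add: norm_divide)

  have "cmod (integral {-1..1} (\<lambda>u. K u *\<^sub>R (h x - h (x - 2 * u))))
      \<le> integral {-1..1} (\<lambda>u. 2 * A * real n powr (- \<alpha>) * (K u + real n * (\<bar>u\<bar> * K u)))"
  proof (rule integral_norm_bound_integral)
    fix u :: real
    have "\<bar>2 * u\<bar> powr \<alpha> \<le> 2 * \<bar>u\<bar> powr \<alpha>"
      using powr_mono[of \<alpha> 1 "2 :: real"] \<alpha>
      by (simp add: powr_mult abs_mult) (simp add: mult_right_mono)
    \<comment> \<open>At the scale \<open>1/n\<close> of the kernel, \<open>s powr \<alpha> \<le> 1 + s\<close> replaces the moment of order \<open>\<alpha>\<close> by the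
      moments of order 0 and 1, with a constant independent of \<open>\<alpha>\<close>.\<close>
    also have "\<bar>u\<bar> powr \<alpha> = real n powr (- \<alpha>) * (real n * \<bar>u\<bar>) powr \<alpha>"
      using n by (simp add: powr_mult powr_minus)
    also have "(real n * \<bar>u\<bar>) powr \<alpha> \<le> 1 + real n * \<bar>u\<bar>"
    proof (cases "real n * \<bar>u\<bar> \<le> 1")
      case True
      then show ?thesis using \<alpha> powr_le1[of \<alpha> "real n * \<bar>u\<bar>"] by (simp add: add_increasing2)
    next
      case False
      then show ?thesis using \<alpha> powr_mono[of \<alpha> 1 "real n * \<bar>u\<bar>"] by simp
    qed
    finally have *: "\<bar>2 * u\<bar> powr \<alpha> \<le> 2 * (real n powr (- \<alpha>) * (1 + real n * \<bar>u\<bar>))"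
      by (simp add: mult_left_mono)
    have "cmod (h x - h (x - 2 * u)) \<le> A * \<bar>2 * u\<bar> powr \<alpha>"
      using holder[of x "x - 2 * u"] by simp
    also have "\<dots> \<le> A * (2 * (real n powr (- \<alpha>) * (1 + real n * \<bar>u\<bar>)))"
      using * A by (intro mult_left_mono)
    finally have "K u * cmod (h x - h (x - 2 * u)) \<le> K u * (A * (2 * (real n powr (- \<alpha>) * (1 + real n * \<bar>u\<bar>))))"
      using K0 by (intro mult_left_mono)
    then show "cmod (K u *\<^sub>R (h x - h (x - 2 * u)))
        \<le> 2 * A * real n powr (- \<alpha>) * (K u + real n * (\<bar>u\<bar> * K u))"
      using K0[of u] by (simp add: algebra_simps flip: scaleR_diff_right)
  qed (auto intro!: integrable_continuous_interval continuous_intros contK conth)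
  also have "\<dots> = 2 * A * real n powr (- \<alpha>) * (I + real n * integral {-1..1} (\<lambda>u. \<bar>u\<bar> * K u))"
    unfolding I_def
    by (subst integral_mult_right, subst integral_add)
      (auto intro!: integrable_continuous_interval continuous_intros contK)
  \<comment> \<open>The first moment is at most \<open>2 \<pi> m\<^sup>2 \<le> 8 m\<^sup>2\<close>; with \<open>n \<le> m/2\<close> and \<open>I \<ge> m\<^sup>3/32\<close>, \<open>n\<close> times it is at most \<open>128 I\<close>.\<close>
  also have "\<dots> \<le> 2 * A * real n powr (- \<alpha>) * (129 * I)"
  proof (intro mult_left_mono)
    have "real n * integral {-1..1} (\<lambda>u. \<bar>u\<bar> * K u) \<le> m / 2 * (2 * 4 * m\<^sup>2)"
    proof (intro mult_mono m)
      have "2 * pi * m\<^sup>2 \<le> 2 * 4 * m\<^sup>2" using pi_less_4 by (intro mult_right_mono) auto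
      then show "integral {-1..1} (\<lambda>u. \<bar>u\<bar> * K u) \<le> 2 * 4 * m\<^sup>2"
        using jackson_first_moment[of n] unfolding K_def m_def by (rule order_trans[rotated])
    qed (use m in \<open>auto intro!: integral_nonneg integrable_continuous_interval continuous_intros contK K0 mult_nonneg_nonneg\<close>)
    also have "\<dots> \<le> 128 * I" using I by (simp add: power2_eq_square power3_eq_cube)
    finally show "I + real n * integral {-1..1} (\<lambda>u. \<bar>u\<bar> * K u) \<le> 129 * I" by simp
  qed (use A in auto)
  finally have err: "cmod (integral {-1..1} (\<lambda>u. K u *\<^sub>R (h x - h (x - 2 * u))))
      \<le> 258 * A * real n powr (- \<alpha>) * I" by (simp add: algebra_simps)

  have "I *\<^sub>R h x = integral {-1..1} (\<lambda>u. K u *\<^sub>R h x)"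
    unfolding I_def
    by (rule integral_unique[OF has_integral_scaleR_left, symmetric])
      (intro integrable_integral integrable_continuous_interval contK)
  also have "\<dots> = integral {-1..1} (\<lambda>u. K u *\<^sub>R (h x - h (x - 2 * u)) + K u *\<^sub>R h (x - 2 * u))"
    by (simp add: algebra_simps)
  also have "\<dots> = integral {-1..1} (\<lambda>u. K u *\<^sub>R (h x - h (x - 2 * u)))
      + integral {-1..1} (\<lambda>u. K u *\<^sub>R h (x - 2 * u))"
    by (intro integral_add integrable_continuous_interval continuous_intros contK conth)
  finally have "cmod (I *\<^sub>R h x) \<le> cmod (integral {-1..1} (\<lambda>u. K u *\<^sub>R (h x - h (x - 2 * u))))
      + cmod (integral {-1..1} (\<lambda>u. K u *\<^sub>R h (x - 2 * u)))"
    by (simp only: norm_triangle_ineq)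
  also have "\<dots> \<le> 258 * A * real n powr (- \<alpha>) * I + 7 ^ (4 * n) * B / 2"
    using err conv by (rule add_mono)
  also have "7 ^ (4 * n) * B / 2 \<le> I * (16 * 7 ^ (4 * n) * B)"
  proof -
    have "7 ^ (4 * n) * B / 2 = 1 / 32 * (16 * 7 ^ (4 * n) * B)" by simp
    also have "\<dots> \<le> I * (16 * 7 ^ (4 * n) * B)" using I32 B by (intro mult_right_mono) auto
    finally show ?thesis .
  qed
  finally have "I * cmod (h x) \<le> I * (258 * A * real n powr (- \<alpha>) + 16 * 7 ^ (4 * n) * B)"
    using I32 by (simp add: algebra_simps)
  then show ?thesis using I32 by simp
qed

section \<open>Trading moments for integrations in the height\<close>

text \<open>As a function of the slope \<open>\<xi>\<close>, the integral of \<open>g(s + \<xi>x)\<close> over heights \<open>s\<close> between \<open>-\<gamma>\<close> and \<open>\<eta>\<close> has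
  the derivative \<open>x (g(\<eta> + \<xi>x) - g(-\<gamma> + \<xi>x))\<close>.  The lower term vanishes because
  \<open>x\<^sup>2 - \<xi>x + \<gamma> = (x - \<xi>/2)\<^sup>2 + (\<gamma> - \<xi>\<^sup>2/4) \<ge> 0\<close>.  The claim is one integration by parts in \<open>\<xi>\<close>; it
  needs no differentiability of \<open>g\<close>.\<close>

lemma integral_by_parts_along_lines:
  fixes g :: "real \<Rightarrow> complex" and \<psi> \<psi>' :: "real \<Rightarrow> real"
  assumes g: "continuous_on UNIV g" and g0: "\<And>y. y \<le> x\<^sup>2 \<Longrightarrow> g y = 0"
    and \<epsilon>: "0 \<le> \<epsilon>" "\<epsilon>\<^sup>2 / 4 \<le> \<gamma>" and \<eta>: "- \<gamma> \<le> \<eta>"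
    and \<psi>: "\<And>\<xi>. (\<psi> has_real_derivative \<psi>' \<xi>) (at \<xi>)" "\<psi> (- \<epsilon>) = 0" "\<psi> \<epsilon> = 0"
    and \<psi>': "continuous_on UNIV \<psi>'"
  shows "x *\<^sub>R integral {-\<epsilon>..\<epsilon>} (\<lambda>\<xi>. \<psi> \<xi> *\<^sub>R g (\<eta> + \<xi> * x))
    = - integral {-\<epsilon>..\<epsilon>} (\<lambda>\<xi>. \<psi>' \<xi> *\<^sub>R integral {-\<gamma>..\<eta>} (\<lambda>s. g (s + \<xi> * x)))"
proof -
  \<comment> \<open>All heights \<open>s + \<xi>x\<close> that occur lie strictly inside \<open>[-b, b]\<close>.\<close>
  define b where "b = \<bar>\<gamma>\<bar> + \<bar>\<eta>\<bar> + \<epsilon> * \<bar>x\<bar> + 1"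
  obtain P where P0: "\<And>u. u \<in> {-b..b} \<Longrightarrow> (P has_vector_derivative g u) (at u within {-b..b})"
    using antiderivative_continuous[OF continuous_on_subset[OF g subset_UNIV], of "-b" b] by blast
  have P: "(P has_vector_derivative g u) (at u)" if "\<bar>u\<bar> < b" for u
    using P0[of u] that at_within_Icc_at[of "-b" u b] by (auto simp: abs_less_iff)
  have inside: "\<bar>s + \<xi> * x\<bar> < b" if "s \<in> {-\<gamma>..\<eta>}" "\<xi> \<in> {-\<epsilon>..\<epsilon>}" for s \<xi>
  proof -
    have "\<bar>\<xi> * x\<bar> \<le> \<epsilon> * \<bar>x\<bar>" using that by (auto simp: abs_mult intro!: mult_right_mono)
    then show ?thesis using that by (auto simp: b_def)
  qed
  define H where "H \<xi> = integral {-\<gamma>..\<eta>} (\<lambda>s. g (s + \<xi> * x))" for \<xi>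
  have HP: "H \<xi> = P (\<eta> + \<xi> * x) - P (- \<gamma> + \<xi> * x)" if \<xi>: "\<xi> \<in> {-\<epsilon>..\<epsilon>}" for \<xi>
    unfolding H_def
  proof (intro integral_unique fundamental_theorem_of_calculus \<eta>)
    fix s assume s: "s \<in> {-\<gamma>..\<eta>}"
    have "((\<lambda>s. s + \<xi> * x) has_vector_derivative 1) (at s within {-\<gamma>..\<eta>})"
      by (auto intro!: derivative_eq_intros)
    from vector_diff_chain_within[OF this has_vector_derivative_at_within[OF P[OF inside[OF s \<xi>]]]]
    show "((\<lambda>s. P (s + \<xi> * x)) has_vector_derivative g (s + \<xi> * x)) (at s within {-\<gamma>..\<eta>})"
      by (simp add: o_def)
  qed
  have DP: "((\<lambda>\<xi>. P (c + \<xi> * x)) has_vector_derivative x *\<^sub>R g (c + \<xi> * x)) (at \<xi>)"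
    if "c \<in> {-\<gamma>..\<eta>}" "\<xi> \<in> {-\<epsilon>..\<epsilon>}" for c \<xi>
  proof -
    have "((\<lambda>\<xi>. c + \<xi> * x) has_vector_derivative x) (at \<xi>)"
      by (auto intro!: derivative_eq_intros)
    from vector_diff_chain_at[OF this P[OF inside[OF that]]] show ?thesis by (simp add: o_def)
  qed
  have low: "g (- \<gamma> + \<xi> * x) = 0" if "\<xi> \<in> {-\<epsilon>..\<epsilon>}" for \<xi>
  proof (rule g0)
    have "\<xi>\<^sup>2 \<le> \<epsilon>\<^sup>2" using that by (auto simp: abs_le_square_iff[symmetric] abs_le_iff)
    moreover have "0 \<le> (x - \<xi> / 2)\<^sup>2" by simp
    ultimately show "- \<gamma> + \<xi> * x \<le> x\<^sup>2" using \<epsilon> by (simp add: power2_eq_square algebra_simps)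
  qed
  define Q where "Q \<xi> = P (\<eta> + \<xi> * x) - P (- \<gamma> + \<xi> * x)" for \<xi>
  have DQ: "(Q has_vector_derivative x *\<^sub>R g (\<eta> + \<xi> * x)) (at \<xi>)" if "\<xi> \<in> {-\<epsilon>..\<epsilon>}" for \<xi>
  proof -
    have "((\<lambda>\<xi>. P (\<eta> + \<xi> * x) - P (- \<gamma> + \<xi> * x)) has_vector_derivative
        (x *\<^sub>R g (\<eta> + \<xi> * x) - x *\<^sub>R g (- \<gamma> + \<xi> * x))) (at \<xi>)"
      using that \<eta> by (intro has_vector_derivative_diff DP) auto
    then show ?thesis using low[OF that] by (simp add: Q_def[abs_def])
  qed
  define y where "y = integral {-\<epsilon>..\<epsilon>} (\<lambda>\<xi>. \<psi> \<xi> *\<^sub>R (x *\<^sub>R g (\<eta> + \<xi> * x)))"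
  have c\<psi>: "continuous_on S \<psi>" for S
    using \<psi>(1) by (meson DERIV_continuous_on has_field_derivative_at_within)
  have cg: "continuous_on S (\<lambda>\<xi>. g (\<eta> + \<xi> * x))" for S
    by (intro continuous_on_compose2[OF g] continuous_intros) auto
  have "((\<lambda>\<xi>. \<psi>' \<xi> *\<^sub>R Q \<xi>) has_integral (- y)) {-\<epsilon>..\<epsilon>}"
  proof (rule integration_by_parts[OF bounded_bilinear_scaleR])
    show "continuous_on {-\<epsilon>..\<epsilon>} Q"
      using DQ by (meson continuous_at_imp_continuous_on has_vector_derivative_continuous)
    have "((\<lambda>\<xi>. \<psi> \<xi> *\<^sub>R (x *\<^sub>R g (\<eta> + \<xi> * x))) has_integral y) {-\<epsilon>..\<epsilon>}"
      unfolding y_def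
      by (intro integrable_integral integrable_continuous_interval continuous_intros cg c\<psi>)
    then show "((\<lambda>\<xi>. \<psi> \<xi> *\<^sub>R (x *\<^sub>R g (\<eta> + \<xi> * x))) has_integral
        \<psi> \<epsilon> *\<^sub>R Q \<epsilon> - \<psi> (- \<epsilon>) *\<^sub>R Q (- \<epsilon>) - (- y)) {-\<epsilon>..\<epsilon>}" by (simp add: \<psi>)
  qed (use \<epsilon> c\<psi> \<psi>(1) DQ in \<open>auto simp: has_real_derivative_iff_has_vector_derivative\<close>)
  then have "integral {-\<epsilon>..\<epsilon>} (\<lambda>\<xi>. \<psi>' \<xi> *\<^sub>R Q \<xi>) = - y" by (rule integral_unique)
  moreover have "integral {-\<epsilon>..\<epsilon>} (\<lambda>\<xi>. \<psi>' \<xi> *\<^sub>R Q \<xi>) = integral {-\<epsilon>..\<epsilon>} (\<lambda>\<xi>. \<psi>' \<xi> *\<^sub>R H \<xi>)"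
    by (intro integral_cong) (simp add: HP Q_def)
  moreover have "y = x *\<^sub>R integral {-\<epsilon>..\<epsilon>} (\<lambda>\<xi>. \<psi> \<xi> *\<^sub>R g (\<eta> + \<xi> * x))"
    unfolding y_def by (subst integral_cmul[symmetric]) (simp add: mult.commute)
  ultimately show ?thesis by (simp add: H_def)
qed

definition line_moment ::
    "(real \<times> real \<Rightarrow> complex) \<Rightarrow> real \<Rightarrow> nat \<Rightarrow> (real \<Rightarrow> real) \<Rightarrow> real \<Rightarrow> complex" where
  "line_moment f \<epsilon> k \<psi> \<eta> =
     integral {-1..1} (\<lambda>x. integral {-\<epsilon>..\<epsilon>} (\<lambda>\<xi>. (\<psi> \<xi> * x ^ k) *\<^sub>R f (x, \<eta> + \<xi> * x)))"

lemma continuous_on_integral_param: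
  fixes F :: "'a::topological_space \<Rightarrow> real \<Rightarrow> complex"
  assumes "continuous_on UNIV (\<lambda>p. F (fst p) (snd p))"
  shows "continuous_on S (\<lambda>q. integral {a..b} (F q))"
proof -
  have "continuous_on (S \<times> cbox a b) (\<lambda>(q, t). F q t)"
    using continuous_on_subset[OF assms subset_UNIV] by (simp add: case_prod_beta)
  from integral_continuous_on_param[OF this] show ?thesis by simp
qed

lemma integral_swap_Icc:
  fixes F :: "real \<Rightarrow> real \<Rightarrow> complex"
  assumes "continuous_on UNIV (\<lambda>p. F (fst p) (snd p))"
  shows "integral {a..b} (\<lambda>x. integral {c..d} (F x)) = integral {c..d} (\<lambda>y. integral {a..b} (\<lambda>x. F x y))"
  using integral_swap_continuous[of a c b d F] continuous_on_subset[OF assms subset_UNIV]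
  by (simp add: case_prod_beta)

lemma line_moment_Suc:
  fixes f :: "real \<times> real \<Rightarrow> complex"
  assumes f: "continuous_on UNIV f" and f0: "\<And>x y. y \<le> x\<^sup>2 \<Longrightarrow> f (x, y) = 0"
    and \<epsilon>: "0 \<le> \<epsilon>" "\<epsilon>\<^sup>2 / 4 \<le> \<gamma>" and \<eta>: "- \<gamma> \<le> \<eta>"
    and \<psi>: "\<And>\<xi>. (\<psi> has_real_derivative \<psi>' \<xi>) (at \<xi>)" "\<psi> (- \<epsilon>) = 0" "\<psi> \<epsilon> = 0"
    and \<psi>': "continuous_on UNIV \<psi>'"
  shows "line_moment f \<epsilon> (Suc k) \<psi> \<eta> = - integral {-\<gamma>..\<eta>} (line_moment f \<epsilon> k \<psi>')"
proof -
  let ?F = "\<lambda>x s \<xi>. (\<psi>' \<xi> * x ^ k) *\<^sub>R f (x, s + \<xi> * x)"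
  have "line_moment f \<epsilon> (Suc k) \<psi> \<eta>
      = integral {-1..1} (\<lambda>x. x *\<^sub>R integral {-\<epsilon>..\<epsilon>} (\<lambda>\<xi>. \<psi> \<xi> *\<^sub>R (x ^ k *\<^sub>R f (x, \<eta> + \<xi> * x))))"
    unfolding line_moment_def by (subst integral_cmul[symmetric]) (simp add: mult_ac)
  also have "\<dots> = integral {-1..1} (\<lambda>x. - integral {-\<epsilon>..\<epsilon>} (\<lambda>\<xi>. \<psi>' \<xi> *\<^sub>R
      integral {-\<gamma>..\<eta>} (\<lambda>s. x ^ k *\<^sub>R f (x, s + \<xi> * x))))"
  proof (intro integral_cong)
    fix x :: real
    have "continuous_on UNIV (\<lambda>y. x ^ k *\<^sub>R f (x, y))"
      by (intro continuous_intros continuous_on_compose2[OF f]) auto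
    then show "x *\<^sub>R integral {-\<epsilon>..\<epsilon>} (\<lambda>\<xi>. \<psi> \<xi> *\<^sub>R (x ^ k *\<^sub>R f (x, \<eta> + \<xi> * x)))
      = - integral {-\<epsilon>..\<epsilon>} (\<lambda>\<xi>. \<psi>' \<xi> *\<^sub>R integral {-\<gamma>..\<eta>} (\<lambda>s. x ^ k *\<^sub>R f (x, s + \<xi> * x)))"
      by (rule integral_by_parts_along_lines) (use assms in auto)
  qed
  also have "\<dots> = - integral {-1..1} (\<lambda>x. integral {-\<epsilon>..\<epsilon>} (\<lambda>\<xi>. integral {-\<gamma>..\<eta>} (\<lambda>s. ?F x s \<xi>)))"
    by (simp flip: integral_cmul)
  also have "(\<lambda>x. integral {-\<epsilon>..\<epsilon>} (\<lambda>\<xi>. integral {-\<gamma>..\<eta>} (\<lambda>s. ?F x s \<xi>)))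
      = (\<lambda>x. integral {-\<gamma>..\<eta>} (\<lambda>s. integral {-\<epsilon>..\<epsilon>} (\<lambda>\<xi>. ?F x s \<xi>)))"
    by (intro ext integral_swap_Icc continuous_intros continuous_on_compose2[OF f]
        continuous_on_compose2[OF \<psi>']) auto
  also have "integral {-1..1} \<dots> = integral {-\<gamma>..\<eta>} (\<lambda>s. integral {-1..1} (\<lambda>x. integral {-\<epsilon>..\<epsilon>} (?F x s)))"
    by (intro integral_swap_Icc continuous_on_integral_param continuous_intros
        continuous_on_compose2[OF f] continuous_on_compose2[OF \<psi>']) auto
  finally show ?thesis unfolding line_moment_def[abs_def] .
qed

lemma continuous_on_line_moment:
  assumes f: "continuous_on UNIV f" and \<psi>: "continuous_on UNIV \<psi>"
  shows "continuous_on S (line_moment f \<epsilon> k \<psi>)"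
  unfolding line_moment_def[abs_def]
  by (intro continuous_on_integral_param continuous_intros
        continuous_on_compose2[OF f] continuous_on_compose2[OF \<psi>]) auto

text \<open>Integrating first in \<open>x\<close> along the line of slope \<open>\<xi>\<close> and height \<open>\<eta>\<close> exhibits the Radon transform.\<close>

lemma line_moment_0_le:
  assumes f: "continuous_on UNIV f" and \<psi>: "continuous_on UNIV \<psi>"
    and b: "\<And>\<xi>. \<bar>\<psi> \<xi>\<bar> \<le> b"
  shows "cmod (line_moment f \<epsilon> 0 \<psi> \<eta>)
      \<le> b * integral {-\<epsilon>..\<epsilon>} (\<lambda>\<xi>. cmod (integral {-1..1} (\<lambda>x. f (x, \<eta> + \<xi> * x))))"
proof -
  have c: "continuous_on S (\<lambda>\<xi>. integral {-1..1} (\<lambda>x. f (x, \<eta> + \<xi> * x)))" for S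
    by (intro continuous_on_integral_param continuous_intros continuous_on_compose2[OF f]) auto
  have "line_moment f \<epsilon> 0 \<psi> \<eta>
      = integral {-\<epsilon>..\<epsilon>} (\<lambda>\<xi>. integral {-1..1} (\<lambda>x. \<psi> \<xi> *\<^sub>R f (x, \<eta> + \<xi> * x)))"
    unfolding line_moment_def
    by (subst integral_swap_Icc)
      (auto intro!: continuous_intros continuous_on_compose2[OF f] continuous_on_compose2[OF \<psi>])
  also have "\<dots> = integral {-\<epsilon>..\<epsilon>} (\<lambda>\<xi>. \<psi> \<xi> *\<^sub>R integral {-1..1} (\<lambda>x. f (x, \<eta> + \<xi> * x)))"
    by simp
  also have "cmod \<dots> \<le> integral {-\<epsilon>..\<epsilon>} (\<lambda>\<xi>. b * cmod (integral {-1..1} (\<lambda>x. f (x, \<eta> + \<xi> * x))))"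
    by (intro integral_norm_bound_integral)
      (auto intro!: integrable_continuous_interval continuous_intros c continuous_on_subset[OF \<psi>] mult_right_mono b)
  finally show ?thesis by simp
qed

text \<open>The innermost of the \<open>k + 1\<close> integrations in the height turns the line integrals into the \<open>L\<^sup>1\<close> norm over the
  rectangle; the other \<open>k\<close> ones are iterated integrals of a constant and produce \<open>(\<eta> + \<gamma>)\<^sup>k / k!\<close>.\<close>

lemma line_moment_le:
  fixes f :: "real \<times> real \<Rightarrow> complex"
  assumes f: "continuous_on UNIV f" and f0: "\<And>x y. y \<le> x\<^sup>2 \<Longrightarrow> f (x, y) = 0"
    and \<epsilon>: "0 \<le> \<epsilon>" "\<epsilon>\<^sup>2 / 4 \<le> \<gamma>" and \<eta>: "- \<gamma> \<le> \<eta>" "\<eta> \<le> \<gamma>"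
    and \<psi>: "\<And>j \<xi>. (\<psi> j has_real_derivative \<psi> (Suc j) \<xi>) (at \<xi>)" "\<And>j. \<psi> j (- \<epsilon>) = 0" "\<And>j. \<psi> j \<epsilon> = 0"
    and b: "\<And>\<xi>. \<bar>\<psi> (j + Suc k) \<xi>\<bar> \<le> b"
  shows "cmod (line_moment f \<epsilon> (Suc k) (\<psi> j) \<eta>) \<le>
      b * integral {-\<gamma>..\<gamma>} (\<lambda>s. integral {-\<epsilon>..\<epsilon>} (\<lambda>\<xi>. cmod (integral {-1..1} (\<lambda>x. f (x, s + \<xi> * x)))))
        * ((\<eta> + \<gamma>) ^ k / fact k)"
proof -
  have c: "continuous_on UNIV (\<psi> j)" for j
    using \<psi>(1) by (meson DERIV_continuous_on has_field_derivative_at_within)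
  have step: "line_moment f \<epsilon> (Suc k) (\<psi> j) \<eta> = - integral {-\<gamma>..\<eta>} (line_moment f \<epsilon> k (\<psi> (Suc j)))"
    if "- \<gamma> \<le> \<eta>" for k j \<eta>
    using that by (intro line_moment_Suc f f0 \<epsilon> \<psi> c) auto
  let ?r = "\<lambda>s. integral {-\<epsilon>..\<epsilon>} (\<lambda>\<xi>. cmod (integral {-1..1} (\<lambda>x. f (x, s + \<xi> * x))))"
  have cr: "continuous_on S ?r" for S
  proof -
    have "continuous_on (S \<times> cbox (-\<epsilon>) \<epsilon>) (\<lambda>(s, \<xi>). cmod (integral {-1..1} (\<lambda>x. f (x, s + \<xi> * x))))"
      unfolding case_prod_beta
      by (intro continuous_intros continuous_on_integral_param continuous_on_compose2[OF f]) auto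
    from integral_continuous_on_param[OF this] show ?thesis by simp
  qed
  have r0: "0 \<le> ?r s" for s
    by (intro integral_nonneg integrable_continuous_interval continuous_intros
        continuous_on_integral_param continuous_on_compose2[OF f]) auto
  have D0: "0 \<le> integral {-\<gamma>..\<gamma>} ?r"
    by (intro integral_nonneg integrable_continuous_interval cr r0)
  have "\<forall>\<xi>. \<bar>\<psi> (j + Suc k) \<xi>\<bar> \<le> b" using b by blast
  then show ?thesis using \<eta>
  proof (induction k arbitrary: j \<eta>)
    case (0 j \<eta>)
    have "cmod (line_moment f \<epsilon> (Suc 0) (\<psi> j) \<eta>) = cmod (integral {-\<gamma>..\<eta>} (line_moment f \<epsilon> 0 (\<psi> (Suc j))))"
      using step[of \<eta> 0 j] 0 by simp
    also have "\<dots> \<le> integral {-\<gamma>..\<eta>} (\<lambda>s. b * ?r s)"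
      using 0(1) by (intro integral_norm_bound_integral integrable_continuous_interval continuous_intros
          cr continuous_on_line_moment f c line_moment_0_le) auto
    also have "\<dots> \<le> integral {-\<gamma>..\<gamma>} (\<lambda>s. b * ?r s)"
    proof -
      have "0 \<le> b" using 0(1) order_trans[OF abs_ge_zero] by blast
      then have "0 \<le> b * ?r s" for s using r0[of s] by simp
      with 0 show ?thesis
        by (intro integral_subset_le integrable_continuous_interval continuous_intros cr) auto
    qed
    finally show ?case by simp
  next
    case (Suc k j \<eta>)
    let ?B = "b * integral {-\<gamma>..\<gamma>} ?r"
    have I: "((\<lambda>s. ?B * ((s + \<gamma>) ^ k / fact k)) has_integral
        ?B * ((\<eta> + \<gamma>) ^ Suc k / fact (Suc k)) - ?B * ((- \<gamma> + \<gamma>) ^ Suc k / fact (Suc k))) {-\<gamma>..\<eta>}"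
    proof (rule fundamental_theorem_of_calculus)
      fix s
      have "((\<lambda>s. (s + \<gamma>) ^ Suc k / fact (Suc k)) has_real_derivative
          (real (Suc k) * (s + \<gamma>) ^ k) / fact (Suc k)) (at s within {-\<gamma>..\<eta>})"
        by (auto intro!: derivative_eq_intros simp del: fact_Suc power_Suc of_nat_Suc)
      also have "(real (Suc k) * (s + \<gamma>) ^ k) / fact (Suc k) = (s + \<gamma>) ^ k / fact k"
        by (simp del: of_nat_Suc)
      finally have "((\<lambda>s. ?B * ((s + \<gamma>) ^ Suc k / fact (Suc k))) has_real_derivative
          ?B * ((s + \<gamma>) ^ k / fact k)) (at s within {-\<gamma>..\<eta>})" by (rule DERIV_cmult)
      then show "((\<lambda>s. ?B * ((s + \<gamma>) ^ Suc k / fact (Suc k))) has_vector_derivative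
          ?B * ((s + \<gamma>) ^ k / fact k)) (at s within {-\<gamma>..\<eta>})"
        by (simp add: has_real_derivative_iff_has_vector_derivative)
    qed (use Suc in auto)
    have "cmod (line_moment f \<epsilon> (Suc (Suc k)) (\<psi> j) \<eta>)
        = cmod (integral {-\<gamma>..\<eta>} (line_moment f \<epsilon> (Suc k) (\<psi> (Suc j))))"
      using step[of \<eta> "Suc k" j] Suc by simp
    also have "\<dots> \<le> integral {-\<gamma>..\<eta>} (\<lambda>s. ?B * ((s + \<gamma>) ^ k / fact k))"
    proof (rule integral_norm_bound_integral)
      show "line_moment f \<epsilon> (Suc k) (\<psi> (Suc j)) integrable_on {-\<gamma>..\<eta>}"
        by (intro integrable_continuous_interval continuous_on_line_moment f c)
      show "(\<lambda>s. ?B * ((s + \<gamma>) ^ k / fact k)) integrable_on {-\<gamma>..\<eta>}" using I by blast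
      fix s assume s: "s \<in> {-\<gamma>..\<eta>}"
      show "cmod (line_moment f \<epsilon> (Suc k) (\<psi> (Suc j)) s) \<le> ?B * ((s + \<gamma>) ^ k / fact k)"
        using Suc.prems s by (intro Suc.IH) auto
    qed
    also have "\<dots> = ?B * ((\<eta> + \<gamma>) ^ Suc k / fact (Suc k))"
      using integral_unique[OF I] by simp
    finally show ?case .
  qed
qed

section \<open>Hoelder functions above the parabola and their Radon transform\<close>

lemma lborel_integral_eq_integral_Icc:
  fixes F :: "real \<Rightarrow> complex"
  assumes "continuous_on {a..b} F" and "\<And>x. x \<notin> {a..b} \<Longrightarrow> F x = 0"
  shows "(LINT x|lborel. F x) = integral {a..b} F"
proof -
  have "(LINT x|lborel. F x) = (LINT x:{a..b}|lborel. F x)"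
    unfolding set_lebesgue_integral_def
    by (intro Bochner_Integration.integral_cong) (auto simp: indicator_def assms(2))
  then show ?thesis
    using set_borel_integral_eq_integral(2)[OF borel_integrable_atLeastAtMost'[OF assms(1)]] by simp
qed

lemma holder_seminorm_bound:
  assumes "holder_seminorm \<alpha> f \<le> ereal A"
  shows "cmod (f p - f q) \<le> A * norm (p - q) powr \<alpha>"
proof (cases "p = q")
  case False
  have "ereal (cmod (f p - f q) / norm (p - q) powr \<alpha>) \<le> holder_seminorm \<alpha> f"
    unfolding holder_seminorm_def using False by (intro SUP_upper2[of "(p, q)"]) auto
  also note assms
  finally show ?thesis using False by (simp add: divide_le_eq)
qed simp

lemma holder_imp_continuous:
  fixes f :: "real \<times> real \<Rightarrow> complex"
  assumes holder: "\<And>p q. cmod (f p - f q) \<le> A * norm (p - q) powr \<alpha>" and \<alpha>: "0 < \<alpha>"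
  shows "continuous_on UNIV f"
proof -
  have "(f \<longlongrightarrow> f p) (at p)" for p
  proof -
    have "((\<lambda>q. norm (q - p) powr \<alpha>) \<longlongrightarrow> norm (p - p) powr \<alpha>) (at p)"
      using \<alpha> by (intro tendsto_intros) auto
    then have "((\<lambda>q. A * norm (q - p) powr \<alpha>) \<longlongrightarrow> 0) (at p)"
      by (intro tendsto_mult_right_zero) simp
    then have "((\<lambda>q. f q - f p) \<longlongrightarrow> 0) (at p)"
      by (rule Lim_null_comparison[rotated]) (use holder in auto)
    then show ?thesis by (simp add: LIM_zero_iff)
  qed
  then show ?thesis by (simp add: continuous_on_eq_continuous_at isCont_def)
qed

text \<open>On the parabola itself, which may belong to the support, \<open>f\<close> vanishes as a limit from below.\<close>

lemma vanishes_below_parabola: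
  fixes f :: "real \<times> real \<Rightarrow> complex"
  assumes f: "continuous_on UNIV f" and supp: "supp f \<subseteq> {(x, y). y \<ge> x\<^sup>2}" and y: "y \<le> x\<^sup>2"
  shows "f (x, y) = 0"
proof -
  have below: "f (x, t) = 0" if "t < x\<^sup>2" for t
    using supp that closure_subset[of "{p. f p \<noteq> 0}"] by (auto simp: supp_def)
  have "((\<lambda>t. f (x, t)) \<longlongrightarrow> f (x, x\<^sup>2)) (at_left (x\<^sup>2))"
  proof -
    have "continuous_on UNIV (\<lambda>t. f (x, t))"
      by (intro continuous_on_compose2[OF f] continuous_intros) auto
    then show ?thesis
      by (auto simp: continuous_on_def intro: tendsto_within_subset)
  qed
  moreover have "((\<lambda>t. f (x, t)) \<longlongrightarrow> 0) (at_left (x\<^sup>2))"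
    by (intro tendsto_eventually) (auto simp: eventually_at_filter below)
  ultimately have "f (x, x\<^sup>2) = 0" by (intro tendsto_unique[of "at_left (x\<^sup>2)"]) auto
  then show ?thesis using below y by (cases "y = x\<^sup>2") auto
qed

text \<open>The positive root of \<open>x\<^sup>2 - \<epsilon>x - \<gamma>\<close> is at most \<open>1\<close> exactly if this polynomial is nonnegative at \<open>1\<close>.\<close>

lemma x_sol_le_1D:
  assumes \<epsilon>: "0 < \<epsilon>" and \<gamma>: "0 < \<gamma>" and le: "x_sol \<epsilon> \<gamma> \<le> 1"
  shows "\<epsilon> + \<gamma> \<le> 1"
proof -
  define r where "r = sqrt (\<epsilon>\<^sup>2 + 4 * \<gamma>)"
  have r: "r\<^sup>2 = \<epsilon>\<^sup>2 + 4 * \<gamma>" "\<epsilon> < r" 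
    using \<epsilon> \<gamma> by (auto simp: r_def intro!: real_less_rsqrt)
  have "x_sol \<epsilon> \<gamma> = (\<epsilon> + r) / 2"
    unfolding x_sol_def
  proof (rule the_equality)
    show "0 < (\<epsilon> + r) / 2 \<and> ((\<epsilon> + r) / 2)\<^sup>2 = \<epsilon> * ((\<epsilon> + r) / 2) + \<gamma>"
      using r \<epsilon> by (simp add: power2_eq_square field_simps)
    fix x assume x: "0 < x \<and> x\<^sup>2 = \<epsilon> * x + \<gamma>"
    then have "(x - (\<epsilon> + r) / 2) * (x - (\<epsilon> - r) / 2) = 0"
      using r by (simp add: power2_eq_square field_simps)
    moreover have "x - (\<epsilon> - r) / 2 \<noteq> 0" using x r by auto
    ultimately show "x = (\<epsilon> + r) / 2" by simp
  qed
  then have "r \<le> 2 - \<epsilon>" using le by simp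
  then have "r\<^sup>2 \<le> (2 - \<epsilon>)\<^sup>2" using r \<epsilon> by (intro power_mono) auto
  then show ?thesis using r by (simp add: power2_eq_square algebra_simps)
qed

lemma slanted_line_above_unit:
  fixes x :: real
  assumes "0 \<le> \<epsilon>" "0 \<le> \<gamma>" "\<epsilon> + \<gamma> \<le> 1" "\<bar>\<xi>\<bar> \<le> \<epsilon>" "\<eta> \<le> \<gamma>" "\<bar>x\<bar> \<ge> 1"
  shows "\<eta> + \<xi> * x \<le> x\<^sup>2"
proof -
  have "\<xi> * x \<le> \<bar>\<xi>\<bar> * \<bar>x\<bar>" using abs_ge_self[of "\<xi> * x"] by (simp add: abs_mult)
  also have "\<dots> \<le> \<epsilon> * \<bar>x\<bar>" using assms by (intro mult_right_mono) auto
  finally have "\<eta> + \<xi> * x \<le> \<gamma> * \<bar>x\<bar> + \<epsilon> * \<bar>x\<bar>"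
    using assms mult_left_mono[of 1 "\<bar>x\<bar>" \<gamma>] by linarith
  also have "\<dots> = (\<epsilon> + \<gamma>) * \<bar>x\<bar>" by (simp add: algebra_simps)
  also have "\<dots> \<le> \<bar>x\<bar> * \<bar>x\<bar>" using assms by (intro mult_right_mono) auto
  finally show ?thesis by (simp add: power2_eq_square)
qed

lemma radon_eq_integral:
  assumes f: "continuous_on UNIV f"
    and f0: "\<And>x. x \<notin> {a..b} \<Longrightarrow> f (x, \<xi> * x + \<eta>) = 0"
  shows "radon f (\<xi>, \<eta>) = integral {a..b} (\<lambda>x. f (x, \<eta> + \<xi> * x))"
proof -
  have "continuous_on {a..b} (\<lambda>x. f (x, \<xi> * x + \<eta>))"
    by (intro continuous_on_compose2[OF f] continuous_intros) auto
  from lborel_integral_eq_integral_Icc[OF this f0] show ?thesis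
    by (simp add: radon_def add.commute)
qed

text \<open>The data norm is only constrained on continuous functions, so it can be applied to \<open>radon f\<close> only after this lemma.
  Near a given point all lines leave the region above the parabola outside a common bounded interval of \<open>x\<close>.\<close>

lemma continuous_on_radon:
  assumes f: "continuous_on UNIV f" and f0: "\<And>x y. y \<le> x\<^sup>2 \<Longrightarrow> f (x, y) = 0"
  shows "continuous_on UNIV (radon f)"
  unfolding continuous_on_eq_continuous_at[OF open_UNIV]
proof
  fix p :: "real \<times> real"
  define r where "r = \<bar>fst p\<bar> + \<bar>snd p\<bar> + 1"
  define U where "U = {q :: real \<times> real. \<bar>fst q\<bar> < r \<and> \<bar>snd q\<bar> < r}"
  have U: "open U" unfolding U_def
    by (intro open_Collect_conj open_Collect_less continuous_intros)
  have "continuous_on (U \<times> cbox (-(r + 2)) (r + 2)) (\<lambda>(q, x). f (x, snd q + fst q * x))"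
    unfolding case_prod_beta by (intro continuous_intros continuous_on_compose2[OF f]) auto
  from integral_continuous_on_param[OF this]
  have "continuous_on U (\<lambda>q. integral {-(r + 2)..r + 2} (\<lambda>x. f (x, snd q + fst q * x)))" by simp
  also have "?this \<longleftrightarrow> continuous_on U (radon f)"
  proof (rule continuous_on_cong[OF refl])
    fix q assume q: "q \<in> U"
    have "radon f (fst q, snd q) = integral {-(r + 2)..r + 2} (\<lambda>x. f (x, snd q + fst q * x))"
    proof (rule radon_eq_integral[OF f])
      fix x assume x: "x \<notin> {-(r + 2)..r + 2}"
      have "fst q * x \<le> \<bar>fst q\<bar> * \<bar>x\<bar>" using abs_ge_self[of "fst q * x"] by (simp add: abs_mult)
      also have "\<dots> \<le> r * \<bar>x\<bar>" using q by (intro mult_right_mono) (auto simp: U_def)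
      finally have "fst q * x + snd q \<le> r * \<bar>x\<bar> + \<bar>x\<bar>" using q x by (auto simp: U_def)
      also have "\<dots> = (r + 1) * \<bar>x\<bar>" by (simp add: algebra_simps)
      also have "\<dots> \<le> \<bar>x\<bar> * \<bar>x\<bar>" using x by (intro mult_right_mono) auto
      finally show "f (x, fst q * x + snd q) = 0" by (intro f0) (simp add: power2_eq_square)
    qed
    then show "integral {-(r + 2)..r + 2} (\<lambda>x. f (x, snd q + fst q * x)) = radon f q" by simp
  qed
  finally have "continuous_on U (radon f)" .
  moreover have "p \<in> U" by (auto simp: U_def r_def intro: add_nonneg_pos)
  ultimately show "isCont (radon f) p"
    using continuous_on_eq_continuous_at[OF U] by blast
qed

lemma nn_integral_Icc_eq_integral:
  fixes g :: "real \<Rightarrow> real"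
  assumes "continuous_on {a..b} g" "\<And>x. x \<in> {a..b} \<Longrightarrow> 0 \<le> g x"
  shows "(\<integral>\<^sup>+x\<in>{a..b}. ennreal (g x) \<partial>lborel) = ennreal (integral {a..b} g)"
  using assms
  by (intro nn_integral_has_integral_lebesgue' integrable_integral integrable_continuous_interval) auto

text \<open>By Tonelli; the edges \<open>\<eta> = \<plusminus>\<gamma>\<close> that \<^const>\<open>data_rect\<close> leaves out form a null set.\<close>

lemma nn_integral_data_rect:
  fixes g :: "real \<times> real \<Rightarrow> complex"
  assumes g: "continuous_on UNIV g"
  shows "(\<integral>\<^sup>+p\<in>data_rect \<epsilon> \<gamma>. ennreal (cmod (g p)) \<partial>lborel)
    = ennreal (integral {-\<gamma>..\<gamma>} (\<lambda>\<eta>. integral {-\<epsilon>..\<epsilon>} (\<lambda>\<xi>. cmod (g (\<xi>, \<eta>)))))"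
proof -
  have gm [measurable]: "g \<in> borel_measurable borel" by (rule borel_measurable_continuous_onI[OF g])
  have dr: "data_rect \<epsilon> \<gamma> = {-\<epsilon>..\<epsilon>} \<times> {-\<gamma><..<\<gamma>}" by (auto simp: data_rect_def)
  have [measurable]: "data_rect \<epsilon> \<gamma> \<in> sets borel"
    unfolding dr by (intro borel_Times) auto
  have c1: "continuous_on S (\<lambda>\<xi>. cmod (g (\<xi>, \<eta>)))" for S \<eta>
    by (intro continuous_intros continuous_on_compose2[OF g]) auto
  have c2: "continuous_on S (\<lambda>\<eta>. integral {-\<epsilon>..\<epsilon>} (\<lambda>\<xi>. cmod (g (\<xi>, \<eta>))))" for S
  proof -
    have "continuous_on (S \<times> cbox (-\<epsilon>) \<epsilon>) (\<lambda>(\<eta>, \<xi>). cmod (g (\<xi>, \<eta>)))"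
      unfolding case_prod_beta by (intro continuous_intros continuous_on_compose2[OF g]) auto
    from integral_continuous_on_param[OF this] show ?thesis by simp
  qed
  have pos: "0 \<le> integral {-\<epsilon>..\<epsilon>} (\<lambda>\<xi>. cmod (g (\<xi>, \<eta>)))" for \<eta>
    by (intro integral_nonneg integrable_continuous_interval c1) auto
  let ?F = "\<lambda>p. ennreal (cmod (g p)) * indicator (data_rect \<epsilon> \<gamma>) p"
  have "(\<integral>\<^sup>+p. ?F p \<partial>lborel) = (\<integral>\<^sup>+p. ?F p \<partial>(lborel \<Otimes>\<^sub>M lborel))" by (simp add: lborel_prod)
  also have "\<dots> = (\<integral>\<^sup>+\<eta>. (\<integral>\<^sup>+\<xi>. ?F (\<xi>, \<eta>) \<partial>lborel) \<partial>lborel)"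
    by (rule lborel_pair.nn_integral_snd[symmetric]) (simp add: lborel_prod)
  also have "\<dots> = (\<integral>\<^sup>+\<eta>. ennreal (integral {-\<epsilon>..\<epsilon>} (\<lambda>\<xi>. cmod (g (\<xi>, \<eta>)))) * indicator {-\<gamma><..<\<gamma>} \<eta> \<partial>lborel)"
  proof (intro nn_integral_cong)
    fix \<eta>
    have "(\<integral>\<^sup>+\<xi>. ?F (\<xi>, \<eta>) \<partial>lborel)
        = (\<integral>\<^sup>+\<xi>. (ennreal (cmod (g (\<xi>, \<eta>))) * indicator {-\<epsilon>..\<epsilon>} \<xi>) * indicator {-\<gamma><..<\<gamma>} \<eta> \<partial>lborel)"
      by (intro nn_integral_cong) (auto simp: dr indicator_def)
    also have "\<dots> = (\<integral>\<^sup>+\<xi>\<in>{-\<epsilon>..\<epsilon>}. ennreal (cmod (g (\<xi>, \<eta>))) \<partial>lborel) * indicator {-\<gamma><..<\<gamma>} \<eta>"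
      by (rule nn_integral_multc) measurable
    finally show "(\<integral>\<^sup>+\<xi>. ?F (\<xi>, \<eta>) \<partial>lborel)
        = ennreal (integral {-\<epsilon>..\<epsilon>} (\<lambda>\<xi>. cmod (g (\<xi>, \<eta>)))) * indicator {-\<gamma><..<\<gamma>} \<eta>"
      by (simp add: nn_integral_Icc_eq_integral[OF c1])
  qed
  also have "\<dots> = (\<integral>\<^sup>+\<eta>\<in>{-\<gamma>..\<gamma>}. ennreal (integral {-\<epsilon>..\<epsilon>} (\<lambda>\<xi>. cmod (g (\<xi>, \<eta>)))) \<partial>lborel)"
  proof (rule nn_integral_cong_AE)
    have "AE \<eta> in lborel. \<eta> \<notin> {-\<gamma>, \<gamma>}" by (intro AE_not_in finite_imp_null_set_lborel) simp
    then show "AE \<eta> in lborel. ennreal (integral {-\<epsilon>..\<epsilon>} (\<lambda>\<xi>. cmod (g (\<xi>, \<eta>)))) * indicator {-\<gamma><..<\<gamma>} \<eta>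
        = ennreal (integral {-\<epsilon>..\<epsilon>} (\<lambda>\<xi>. cmod (g (\<xi>, \<eta>)))) * indicator {-\<gamma>..\<gamma>} \<eta>"
      by eventually_elim (auto simp: indicator_def)
  qed
  also have "\<dots> = ennreal (integral {-\<gamma>..\<gamma>} (\<lambda>\<eta>. integral {-\<epsilon>..\<epsilon>} (\<lambda>\<xi>. cmod (g (\<xi>, \<eta>)))))"
    by (intro nn_integral_Icc_eq_integral c2 pos)
  finally show ?thesis .
qed

section \<open>The mean as an average over slopes\<close>

text \<open>Substitute \<open>y = \<gamma> + \<xi>x\<close>; evenness of \<open>\<phi>\<close> removes the sign of \<open>x\<close>.  The separate value of the mean at \<open>x = 0\<close>
  is the one that makes the formula hold there too.\<close>

lemma mean_eq_integral_slopes: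
  assumes f: "continuous_on UNIV f" and \<phi>: "continuous_on UNIV \<phi>"
    and \<phi>0: "\<And>t. \<bar>t\<bar> > 1 \<Longrightarrow> \<phi> t = 0" and even: "\<And>t. \<phi> (- t) = \<phi> t"
    and one: "(LINT t|lborel. \<phi> t) = 1" and \<epsilon>: "0 < \<epsilon>"
  shows "mean \<phi> \<epsilon> \<gamma> f x = integral {-\<epsilon>..\<epsilon>} (\<lambda>\<xi>. (\<phi> (\<xi> / \<epsilon>) / \<epsilon>) *\<^sub>R f (x, \<gamma> + \<xi> * x))"
proof -
  have c: "continuous_on S (\<lambda>\<xi>. (\<phi> (\<xi> / \<epsilon>) / \<epsilon>) *\<^sub>R f (x, \<gamma> + \<xi> * x))" for S
    using \<epsilon> by (intro continuous_intros continuous_on_compose2[OF f] continuous_on_compose2[OF \<phi>]) auto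
  have "(LINT \<xi>|lborel. (\<phi> (\<xi> / \<epsilon>) / \<epsilon>) *\<^sub>R f (x, \<gamma> + \<xi> * x))
      = integral {-\<epsilon>..\<epsilon>} (\<lambda>\<xi>. (\<phi> (\<xi> / \<epsilon>) / \<epsilon>) *\<^sub>R f (x, \<gamma> + \<xi> * x))"
  proof (rule lborel_integral_eq_integral_Icc[OF c])
    fix \<xi> assume "\<xi> \<notin> {-\<epsilon>..\<epsilon>}"
    then have "\<bar>\<xi> / \<epsilon>\<bar> > 1" using \<epsilon> by (auto simp: less_divide_eq)
    then show "(\<phi> (\<xi> / \<epsilon>) / \<epsilon>) *\<^sub>R f (x, \<gamma> + \<xi> * x) = 0" using \<phi>0 by simp
  qed
  moreover have "(LINT \<xi>|lborel. (\<phi> (\<xi> / \<epsilon>) / \<epsilon>) *\<^sub>R f (x, \<gamma> + \<xi> * x)) = mean \<phi> \<epsilon> \<gamma> f x"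
  proof (cases "x = 0")
    case True
    have "(LINT \<xi>|lborel. \<phi> (\<xi> / \<epsilon>) / \<epsilon>) = (LINT t|lborel. \<phi> t)"
      using lborel_integral_real_affine[of \<epsilon> "\<lambda>\<xi>. \<phi> (\<xi> / \<epsilon>) / \<epsilon>" 0] \<epsilon> by simp
    then have "(LINT \<xi>|lborel. \<phi> (\<xi> / \<epsilon>) / \<epsilon>) = 1" using one by simp
    moreover from this have "integrable lborel (\<lambda>\<xi>. \<phi> (\<xi> / \<epsilon>) / \<epsilon>)"
      using not_integrable_integral_eq by fastforce
    ultimately have "(LINT \<xi>|lborel. (\<phi> (\<xi> / \<epsilon>) / \<epsilon>) *\<^sub>R f (0, \<gamma>)) = f (0, \<gamma>)"
      by (subst integral_scaleR_left) auto
    then show ?thesis using True by (simp add: mean_def)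
  next
    case False
    have "mean \<phi> \<epsilon> \<gamma> f x = (LINT y|lborel. f (x, y) * complex_of_real (dilate \<phi> (\<epsilon> * \<bar>x\<bar>) (\<gamma> - y)))"
      using False by (simp add: mean_def)
    also have "\<dots> = \<bar>x\<bar> *\<^sub>R (LINT \<xi>|lborel. f (x, \<gamma> + x * \<xi>)
        * complex_of_real (dilate \<phi> (\<epsilon> * \<bar>x\<bar>) (\<gamma> - (\<gamma> + x * \<xi>))))"
      by (rule lborel_integral_real_affine[OF False])
    also have "\<dots> = (LINT \<xi>|lborel. \<bar>x\<bar> *\<^sub>R (f (x, \<gamma> + x * \<xi>)
        * complex_of_real (dilate \<phi> (\<epsilon> * \<bar>x\<bar>) (\<gamma> - (\<gamma> + x * \<xi>)))))"
      by simp
    also have "\<dots> = (LINT \<xi>|lborel. (\<phi> (\<xi> / \<epsilon>) / \<epsilon>) *\<^sub>R f (x, \<gamma> + \<xi> * x))"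
    proof (intro Bochner_Integration.integral_cong refl)
      fix \<xi>
      have "\<phi> (- (x * \<xi>) / (\<epsilon> * \<bar>x\<bar>)) = \<phi> (\<xi> / \<epsilon>)"
        using False even[of "\<xi> / \<epsilon>"] by (cases "x > 0") (auto simp: abs_if)
      then have d: "\<bar>x\<bar> * dilate \<phi> (\<epsilon> * \<bar>x\<bar>) (\<gamma> - (\<gamma> + x * \<xi>)) = \<phi> (\<xi> / \<epsilon>) / \<epsilon>"
        using False \<epsilon> by (simp add: dilate_def)
      have "\<bar>x\<bar> *\<^sub>R (f (x, \<gamma> + x * \<xi>) * complex_of_real r) = (\<bar>x\<bar> * r) *\<^sub>R f (x, \<gamma> + \<xi> * x)" for r
        by (simp add: scaleR_conv_of_real mult_ac)
      then show "\<bar>x\<bar> *\<^sub>R (f (x, \<gamma> + x * \<xi>) * complex_of_real (dilate \<phi> (\<epsilon> * \<bar>x\<bar>) (\<gamma> - (\<gamma> + x * \<xi>))))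
          = (\<phi> (\<xi> / \<epsilon>) / \<epsilon>) *\<^sub>R f (x, \<gamma> + \<xi> * x)"
        by (simp only: d)
    qed
    finally show ?thesis ..
  qed
  ultimately show ?thesis by simp
qed

text \<open>That all derivatives vanish at the end points \<open>\<plusminus>1\<close> too, by continuity, is what kills the boundary terms in the
  integrations by parts.\<close>

lemma mean_kernelD:
  assumes "mean_kernel \<phi>"
  shows "((deriv ^^ k) \<phi> has_real_derivative (deriv ^^ Suc k) \<phi> t) (at t)"
    and "\<bar>t\<bar> \<ge> 1 \<Longrightarrow> (deriv ^^ k) \<phi> t = 0"
proof -
  have D: "((deriv ^^ k) \<phi> has_real_derivative (deriv ^^ Suc k) \<phi> t) (at t)" for k t
    using assms by (auto simp: mean_kernel_def smooth_def DERIV_deriv_iff_real_differentiable)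
  have out: "(deriv ^^ k) \<phi> t = 0" if "\<bar>t\<bar> > 1" for k t
    using that
  proof (induction k arbitrary: t)
    case 0
    then show ?case
      using assms closure_subset[of "{p. \<phi> p \<noteq> 0}"] by (force simp: mean_kernel_def supp_def)
  next
    case (Suc k)
    have "open {t :: real. 1 < \<bar>t\<bar>}" by (intro open_Collect_less continuous_intros)
    then have ev: "eventually (\<lambda>s. 1 < \<bar>s\<bar>) (nhds t)"
      using Suc.prems eventually_nhds by blast
    then have "eventually (\<lambda>s. (deriv ^^ k) \<phi> s = 0) (nhds t)"
      by eventually_elim (rule Suc.IH)
    then have "((\<lambda>_. 0) has_real_derivative (deriv ^^ Suc k) \<phi> t) (at t)"
      using D[of k t] by (subst (asm) DERIV_cong_ev[OF refl _ refl]) auto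
    then show ?case using DERIV_unique DERIV_const by blast
  qed
  show "((deriv ^^ k) \<phi> has_real_derivative (deriv ^^ Suc k) \<phi> t) (at t)" by (rule D)
  assume t: "\<bar>t\<bar> \<ge> 1"
  show "(deriv ^^ k) \<phi> t = 0"
  proof (cases "\<bar>t\<bar> = 1")
    case True
    have "((\<lambda>s. (deriv ^^ k) \<phi> (t * s)) \<longlongrightarrow> (deriv ^^ k) \<phi> (t * 1)) (at_right 1)"
      by (intro isCont_tendsto_compose[OF DERIV_isCont[OF D]] tendsto_intros)
    moreover have "((\<lambda>s. (deriv ^^ k) \<phi> (t * s)) \<longlongrightarrow> 0) (at_right 1)"
      by (intro tendsto_eventually eventually_mono[OF eventually_at_right_less])
        (auto simp: abs_mult True intro!: out)
    ultimately show ?thesis by (intro tendsto_unique[of "at_right (1::real)"]) auto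
  qed (use t out in auto)
qed

lemma mean_kernel_continuous: "mean_kernel \<phi> \<Longrightarrow> continuous_on S ((deriv ^^ k) \<phi>)"
  by (meson DERIV_continuous_on has_field_derivative_at_within mean_kernelD(1))

lemma mean_kernel_as_integral:
  assumes "mean_kernel \<phi>" and "continuous_on UNIV f" and "0 < \<epsilon>"
  shows "mean \<phi> \<epsilon> \<gamma> f x = integral {-\<epsilon>..\<epsilon>} (\<lambda>\<xi>. (\<phi> (\<xi> / \<epsilon>) / \<epsilon>) *\<^sub>R f (x, \<gamma> + \<xi> * x))"
  using assms mean_kernelD(2)[OF assms(1), of _ 0] mean_kernel_continuous[OF assms(1), of UNIV 0]
  by (intro mean_eq_integral_slopes) (auto simp: mean_kernel_def)

lemma continuous_on_mean:
  assumes \<phi>: "mean_kernel \<phi>" and f: "continuous_on UNIV f" and \<epsilon>: "0 < \<epsilon>"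
  shows "continuous_on S (mean \<phi> \<epsilon> \<gamma> f)"
proof -
  have c\<phi>: "continuous_on UNIV \<phi>" using mean_kernel_continuous[OF \<phi>, of UNIV 0] by simp
  have "continuous_on (S \<times> cbox (-\<epsilon>) \<epsilon>) (\<lambda>(x, \<xi>). (\<phi> (\<xi> / \<epsilon>) / \<epsilon>) *\<^sub>R f (x, \<gamma> + \<xi> * x))"
    unfolding case_prod_beta using \<epsilon>
    by (intro continuous_intros continuous_on_compose2[OF f] continuous_on_compose2[OF c\<phi>]) auto
  from integral_continuous_on_param[OF this]
  show ?thesis unfolding mean_kernel_as_integral[OF assms, abs_def] by simp
qed

lemma mean_eq_0_outside:
  assumes \<phi>: "mean_kernel \<phi>" and f: "continuous_on UNIV f" and f0: "\<And>x y. y \<le> x\<^sup>2 \<Longrightarrow> f (x, y) = 0"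
    and \<epsilon>: "0 < \<epsilon>" "0 \<le> \<gamma>" "\<epsilon> + \<gamma> \<le> 1" and x: "\<bar>x\<bar> > 1"
  shows "mean \<phi> \<epsilon> \<gamma> f x = 0"
proof -
  have "f (x, \<gamma> + \<xi> * x) = 0" if "\<xi> \<in> {-\<epsilon>..\<epsilon>}" for \<xi>
    using \<epsilon> x that by (intro f0 slanted_line_above_unit[of \<epsilon> \<gamma>]) auto
  then have "integral {-\<epsilon>..\<epsilon>} (\<lambda>\<xi>. (\<phi> (\<xi> / \<epsilon>) / \<epsilon>) *\<^sub>R f (x, \<gamma> + \<xi> * x)) = integral {-\<epsilon>..\<epsilon>} (\<lambda>_. 0)"
    by (intro integral_cong) simp
  then show ?thesis by (simp add: mean_kernel_as_integral[OF \<phi> f \<epsilon>(1)])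
qed

text \<open>For slopes at most \<open>1\<close> in modulus, the points over \<open>x\<close> and \<open>y\<close> on a line are at distance at most
  \<open>2|x - y|\<close>, and the weights in the slope have total mass \<open>1\<close>.\<close>

lemma mean_holder:
  assumes \<phi>: "mean_kernel \<phi>" and holder: "\<And>p q. cmod (f p - f q) \<le> A * norm (p - q) powr \<alpha>"
    and \<alpha>: "0 < \<alpha>" "\<alpha> \<le> 1" and \<epsilon>: "0 < \<epsilon>" "\<epsilon> \<le> 1"
  shows "cmod (mean \<phi> \<epsilon> \<gamma> f x - mean \<phi> \<epsilon> \<gamma> f y) \<le> 2 * A * \<bar>x - y\<bar> powr \<alpha>"
proof -
  define w where "w \<xi> = \<phi> (\<xi> / \<epsilon>) / \<epsilon>" for \<xi>
  have f: "continuous_on UNIV f" by (rule holder_imp_continuous[OF holder \<alpha>(1)])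
  have c\<phi>: "continuous_on UNIV \<phi>" using mean_kernel_continuous[OF \<phi>, of UNIV 0] by simp
  have cw: "continuous_on S w" for S
    unfolding w_def using \<epsilon> by (intro continuous_intros continuous_on_compose2[OF c\<phi>]) auto
  have w0: "0 \<le> w \<xi>" for \<xi> using \<phi> \<epsilon> by (simp add: w_def mean_kernel_def)
  have cf: "continuous_on S (\<lambda>\<xi>. f (z, \<gamma> + \<xi> * z))" for S z
    by (intro continuous_intros continuous_on_compose2[OF f]) auto
  have "((\<lambda>\<xi>. w \<xi> *\<^sub>R (1 :: complex)) has_integral integral {-\<epsilon>..\<epsilon>} w *\<^sub>R 1) {-\<epsilon>..\<epsilon>}"
    by (intro has_integral_scaleR_left integrable_integral integrable_continuous_interval cw)
  \<comment> \<open>The total mass is the mean of the constant function \<open>1\<close>.\<close>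
  then have "mean \<phi> \<epsilon> \<gamma> (\<lambda>_. 1) 0 = integral {-\<epsilon>..\<epsilon>} w *\<^sub>R 1"
    unfolding mean_kernel_as_integral[OF \<phi> continuous_on_const \<epsilon>(1)] w_def by (rule integral_unique)
  moreover have "mean \<phi> \<epsilon> \<gamma> (\<lambda>_. 1) 0 = 1" by (simp add: mean_def)
  ultimately have one: "integral {-\<epsilon>..\<epsilon>} w = 1"
    by (metis of_real_eq_1_iff scaleR_conv_of_real mult.right_neutral)
  have A: "0 \<le> A" using order_trans[OF norm_ge_zero holder[of "(1, 0)" 0]] by (simp add: norm_Pair)
  have "mean \<phi> \<epsilon> \<gamma> f x - mean \<phi> \<epsilon> \<gamma> f y
      = integral {-\<epsilon>..\<epsilon>} (\<lambda>\<xi>. w \<xi> *\<^sub>R f (x, \<gamma> + \<xi> * x) - w \<xi> *\<^sub>R f (y, \<gamma> + \<xi> * y))"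
    unfolding mean_kernel_as_integral[OF \<phi> f \<epsilon>(1)] w_def[symmetric]
    by (intro Henstock_Kurzweil_Integration.integral_diff[symmetric]
        integrable_continuous_interval continuous_intros cw cf)
  also have "cmod \<dots> \<le> integral {-\<epsilon>..\<epsilon>} (\<lambda>\<xi>. w \<xi> * (2 * A * \<bar>x - y\<bar> powr \<alpha>))"
  proof (rule integral_norm_bound_integral)
    fix \<xi> assume \<xi>: "\<xi> \<in> {-\<epsilon>..\<epsilon>}"
    have "norm ((x, \<gamma> + \<xi> * x) - (y, \<gamma> + \<xi> * y)) \<le> \<bar>x - y\<bar> + \<bar>\<xi> * (x - y)\<bar>"
      using norm_Pair_le[of "x - y" "\<xi> * (x - y)"] by (simp add: algebra_simps)
    also have "\<dots> \<le> \<bar>x - y\<bar> + 1 * \<bar>x - y\<bar>"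
      unfolding abs_mult using \<xi> \<epsilon> by (intro add_left_mono mult_right_mono) auto
    finally have "norm ((x, \<gamma> + \<xi> * x) - (y, \<gamma> + \<xi> * y)) powr \<alpha> \<le> (2 * \<bar>x - y\<bar>) powr \<alpha>"
      using \<alpha> by (intro powr_mono2) auto
    also have "\<dots> \<le> 2 * \<bar>x - y\<bar> powr \<alpha>"
      using powr_mono[of \<alpha> 1 "2 :: real"] \<alpha> by (simp add: powr_mult mult_right_mono)
    finally have "A * norm ((x, \<gamma> + \<xi> * x) - (y, \<gamma> + \<xi> * y)) powr \<alpha> \<le> A * (2 * \<bar>x - y\<bar> powr \<alpha>)"
      using A by (rule mult_left_mono)
    with holder[of "(x, \<gamma> + \<xi> * x)" "(y, \<gamma> + \<xi> * y)"]
    have "cmod (f (x, \<gamma> + \<xi> * x) - f (y, \<gamma> + \<xi> * y)) \<le> 2 * A * \<bar>x - y\<bar> powr \<alpha>"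
      by simp
    then have "w \<xi> * cmod (f (x, \<gamma> + \<xi> * x) - f (y, \<gamma> + \<xi> * y)) \<le> w \<xi> * (2 * A * \<bar>x - y\<bar> powr \<alpha>)"
      using w0 by (intro mult_left_mono)
    then show "cmod (w \<xi> *\<^sub>R f (x, \<gamma> + \<xi> * x) - w \<xi> *\<^sub>R f (y, \<gamma> + \<xi> * y)) \<le> w \<xi> * (2 * A * \<bar>x - y\<bar> powr \<alpha>)"
      using w0[of \<xi>] by (simp flip: scaleR_diff_right)
  qed (auto intro!: integrable_continuous_interval continuous_intros cw cf)
  also have "\<dots> = 2 * A * \<bar>x - y\<bar> powr \<alpha>" by (simp add: one)
  finally show ?thesis .
qed

text \<open>For \<open>k = 0\<close> the truncated \<open>k - 1\<close> makes the last factor \<open>1\<close>.  This is the case in which no integration in the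
  height takes place and the bound on the line \<open>\<eta> = \<gamma>\<close> is needed.\<close>

lemma mean_moment_le:
  assumes \<phi>: "mean_kernel \<phi>" and f: "continuous_on UNIV f" and f0: "\<And>x y. y \<le> x\<^sup>2 \<Longrightarrow> f (x, y) = 0"
    and \<epsilon>: "0 < \<epsilon>" "\<epsilon>\<^sup>2 / 4 \<le> \<gamma>" "\<epsilon> + \<gamma> \<le> 1"
    and \<beta>: "\<And>t. \<bar>(deriv ^^ k) \<phi> t\<bar> \<le> \<beta>"
    and rect: "integral {-\<gamma>..\<gamma>} (\<lambda>\<eta>. integral {-\<epsilon>..\<epsilon>} (\<lambda>\<xi>. cmod (radon f (\<xi>, \<eta>)))) \<le> d"
    and top: "integral {-\<epsilon>..\<epsilon>} (\<lambda>\<xi>. cmod (radon f (\<xi>, \<gamma>))) \<le> d"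
  shows "cmod (integral {-1..1} (\<lambda>x. x ^ k *\<^sub>R mean \<phi> \<epsilon> \<gamma> f x))
    \<le> \<beta> / \<epsilon> ^ Suc k * d * (2 ^ (k - 1) / fact (k - 1))"
proof -
  define \<psi> where "\<psi> j \<xi> = (deriv ^^ j) \<phi> (\<xi> / \<epsilon>) / \<epsilon> ^ Suc j" for j \<xi>
  have D\<psi>: "(\<psi> j has_real_derivative \<psi> (Suc j) \<xi>) (at \<xi>)" for j \<xi>
  proof -
    have "((\<lambda>\<xi>. \<xi> / \<epsilon>) has_real_derivative 1 / \<epsilon>) (at \<xi>)"
      using \<epsilon> by (auto intro!: derivative_eq_intros)
    from DERIV_cdivide[OF DERIV_chain2[OF mean_kernelD(1)[OF \<phi>, of j] this], of "\<epsilon> ^ Suc j"]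
    show ?thesis unfolding \<psi>_def[abs_def] by (simp add: mult_ac)
  qed
  have ends: "\<psi> j (- \<epsilon>) = 0" "\<psi> j \<epsilon> = 0" for j
    using \<epsilon> mean_kernelD(2)[OF \<phi>, of "-1" j] mean_kernelD(2)[OF \<phi>, of 1 j] by (simp_all add: \<psi>_def)
  have c\<psi>: "continuous_on UNIV (\<psi> j)" for j
    using D\<psi> by (meson DERIV_continuous_on has_field_derivative_at_within)
  have b: "\<bar>\<psi> k \<xi>\<bar> \<le> \<beta> / \<epsilon> ^ Suc k" for \<xi>
    using \<beta>[of "\<xi> / \<epsilon>"] \<epsilon> by (simp add: \<psi>_def abs_mult divide_right_mono power_abs)
  have b0: "0 \<le> \<beta> / \<epsilon> ^ Suc k" using b[of 0] by linarith
  have \<gamma>: "0 \<le> \<gamma>" using \<epsilon> zero_le_power2[of \<epsilon>] by linarith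
  have rad: "integral {-1..1} (\<lambda>x. f (x, \<eta> + \<xi> * x)) = radon f (\<xi>, \<eta>)"
    if "\<xi> \<in> {-\<epsilon>..\<epsilon>}" "\<eta> \<le> \<gamma>" for \<xi> \<eta>
  proof (rule radon_eq_integral[OF f, symmetric])
    fix x :: real assume "x \<notin> {-1..1}"
    then have "\<eta> + \<xi> * x \<le> x\<^sup>2"
      using that \<epsilon> \<gamma> by (intro slanted_line_above_unit[of \<epsilon> \<gamma>]) auto
    then show "f (x, \<xi> * x + \<eta>) = 0" by (intro f0) simp
  qed
  have rad1: "integral {-\<epsilon>..\<epsilon>} (\<lambda>\<xi>. cmod (integral {-1..1} (\<lambda>x. f (x, \<eta> + \<xi> * x))))
      = integral {-\<epsilon>..\<epsilon>} (\<lambda>\<xi>. cmod (radon f (\<xi>, \<eta>)))" if "\<eta> \<le> \<gamma>" for \<eta>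
    using rad that by (intro integral_cong) simp
  have "integral {-1..1} (\<lambda>x. x ^ k *\<^sub>R mean \<phi> \<epsilon> \<gamma> f x) = line_moment f \<epsilon> k (\<psi> 0) \<gamma>"
    unfolding line_moment_def mean_kernel_as_integral[OF \<phi> f \<epsilon>(1)]
    by (subst integral_cmul[symmetric]) (simp add: \<psi>_def mult.commute)
  also have "cmod \<dots> \<le> \<beta> / \<epsilon> ^ Suc k * d * (2 ^ (k - 1) / fact (k - 1))"
  proof (cases k)
    case 0
    have "cmod (line_moment f \<epsilon> 0 (\<psi> 0) \<gamma>) \<le> \<beta> / \<epsilon> ^ Suc k * integral {-\<epsilon>..\<epsilon>} (\<lambda>\<xi>. cmod (radon f (\<xi>, \<gamma>)))"
      using line_moment_0_le[OF f c\<psi>, of 0 "\<beta> / \<epsilon> ^ Suc k" \<epsilon> \<gamma>] b rad1[of \<gamma>] 0 by simp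
    also have "\<dots> \<le> \<beta> / \<epsilon> ^ Suc k * d" using b0 by (intro mult_left_mono top)
    finally show ?thesis using 0 by simp
  next
    case (Suc i)
    have "cmod (line_moment f \<epsilon> (Suc i) (\<psi> 0) \<gamma>) \<le> \<beta> / \<epsilon> ^ Suc k
        * integral {-\<gamma>..\<gamma>} (\<lambda>\<eta>. integral {-\<epsilon>..\<epsilon>} (\<lambda>\<xi>. cmod (integral {-1..1} (\<lambda>x. f (x, \<eta> + \<xi> * x)))))
        * ((\<gamma> + \<gamma>) ^ i / fact i)"
      using \<epsilon> \<gamma> b Suc by (intro line_moment_le f f0 D\<psi> ends) auto
    also have "integral {-\<gamma>..\<gamma>} (\<lambda>\<eta>. integral {-\<epsilon>..\<epsilon>} (\<lambda>\<xi>. cmod (integral {-1..1} (\<lambda>x. f (x, \<eta> + \<xi> * x)))))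
        = integral {-\<gamma>..\<gamma>} (\<lambda>\<eta>. integral {-\<epsilon>..\<epsilon>} (\<lambda>\<xi>. cmod (radon f (\<xi>, \<eta>))))"
      by (rule integral_cong) (simp add: rad1)
    also have "\<beta> / \<epsilon> ^ Suc k * \<dots> * ((\<gamma> + \<gamma>) ^ i / fact i) \<le> \<beta> / \<epsilon> ^ Suc k * d * (2 ^ i / fact i)"
    proof (rule mult_mono)
      show "\<beta> / \<epsilon> ^ Suc k * integral {-\<gamma>..\<gamma>} (\<lambda>\<eta>. integral {-\<epsilon>..\<epsilon>} (\<lambda>\<xi>. cmod (radon f (\<xi>, \<eta>))))
          \<le> \<beta> / \<epsilon> ^ Suc k * d" by (rule mult_left_mono[OF rect b0])
      show "(\<gamma> + \<gamma>) ^ i / fact i \<le> 2 ^ i / fact i"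
        using \<epsilon> \<gamma> by (intro divide_right_mono power_mono) auto
      have "0 \<le> integral {-\<epsilon>..\<epsilon>} (\<lambda>\<xi>. cmod (radon f (\<xi>, \<gamma>)))"
        by (intro integral_nonneg integrable_continuous_interval continuous_intros
            continuous_on_compose2[OF continuous_on_radon[OF f f0]]) auto
      then have "0 \<le> d" using top by linarith
      then show "0 \<le> \<beta> / \<epsilon> ^ Suc k * d" using b0 by (intro mult_nonneg_nonneg)
      show "0 \<le> (\<gamma> + \<gamma>) ^ i / fact i" using \<gamma> by simp
    qed
    finally show ?thesis using Suc by simp
  qed
  finally show ?thesis .
qed

section \<open>Balancing approximation and data error\<close>

lemma power_div_fact_le_exp:
  fixes x :: real
  assumes "0 \<le> x"
  shows "x ^ k / fact k \<le> exp x"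
proof -
  have "(\<Sum>n\<in>{k}. x ^ n /\<^sub>R fact n) \<le> (\<Sum>n. x ^ n /\<^sub>R fact n)"
    using assms sums_summable[OF exp_converges[of x]] by (intro sum_le_suminf) auto
  also have "\<dots> = exp x" by (rule sums_unique[OF exp_converges, symmetric])
  finally have "(\<Sum>n\<in>{k}. x ^ n /\<^sub>R fact n) \<le> exp x" .
  then show ?thesis by (simp add: field_simps)
qed

text \<open>The left-hand side is the factor in front of the data error in the moment bound, with the derivative bounds of the test
  sequence inserted.  The factorial turns \<open>N\<^sup>k\<close> into \<open>exp (3N)\<close>, so that the growth is exponential in \<open>N\<close>
  and not factorial; the logarithmic rate depends on this.\<close>

lemma moment_growth:
  fixes B \<epsilon> :: real
  assumes B: "1 \<le> B" and \<epsilon>: "0 < \<epsilon>" "\<epsilon> < 1" and k: "k \<le> N" and N: "1 \<le> N"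
  shows "B ^ (k + 1) * real N ^ k / \<epsilon> ^ Suc k * (2 ^ (k - 1) / fact (k - 1)) \<le> (B * exp 3 / \<epsilon>) ^ (N + 1)"
proof -
  have 1: "real N ^ k * (2 ^ (k - 1) / fact (k - 1)) \<le> exp 3 ^ N"
  proof (cases k)
    case 0
    then show ?thesis by simp
  next
    case (Suc i)
    have "real N \<le> exp (real N)" using exp_ge_add_one_self[of "real N"] by linarith
    have "real N ^ k * (2 ^ (k - 1) / fact (k - 1)) = real N * ((2 * real N) ^ i / fact i)"
      by (simp add: Suc power_mult_distrib)
    also have "\<dots> \<le> exp (real N) * exp (2 * real N)"
      using \<open>real N \<le> exp (real N)\<close> by (intro mult_mono power_div_fact_le_exp) auto
    also have "\<dots> = exp 3 ^ N" by (simp flip: exp_add exp_of_nat_mult)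
    finally show ?thesis .
  qed
  have q: "1 \<le> B / \<epsilon>" using B \<epsilon> by simp
  have "B ^ (k + 1) * real N ^ k / \<epsilon> ^ Suc k * (2 ^ (k - 1) / fact (k - 1))
      = (B / \<epsilon>) ^ (k + 1) * (real N ^ k * (2 ^ (k - 1) / fact (k - 1)))"
    by (simp add: power_divide)
  also have "\<dots> \<le> (B / \<epsilon>) ^ (N + 1) * exp 3 ^ (N + 1)"
  proof (intro mult_mono power_increasing q)
    show "real N ^ k * (2 ^ (k - 1) / fact (k - 1)) \<le> exp 3 ^ (N + 1)"
      by (rule order_trans[OF 1 power_increasing]) auto
    show "0 \<le> (B / \<epsilon>) ^ (N + 1)" using q by (intro zero_le_power) linarith
  qed (use k in auto)
  also have "\<dots> = (B * exp 3 / \<epsilon>) ^ (N + 1)" by (simp add: power_mult_distrib[symmetric])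
  finally show ?thesis .
qed

lemma L2_norm_le:
  assumes S: "\<And>x. \<bar>x\<bar> \<le> 1 \<Longrightarrow> cmod (g x) \<le> S"
  shows "L2_norm g \<le> 2 * S"
proof -
  have S0: "0 \<le> S" using order_trans[OF norm_ge_zero S[of 0]] by simp
  have "(LINT x:{-1..1}|lborel. (cmod (g x))\<^sup>2) \<le> (LINT x:{-1..1::real}|lborel. S\<^sup>2)"
    unfolding set_lebesgue_integral_def
  proof (rule integral_mono')
    show "integrable lborel (\<lambda>x. indicat_real {-1..1::real} x *\<^sub>R S\<^sup>2)"
      by (intro integrable_scaleR_left integrable_real_indicator) (auto simp: emeasure_lborel_Icc)
  qed (auto simp: indicator_def intro!: power_mono S)
  also have "\<dots> = 2 * S\<^sup>2" by (simp add: set_lebesgue_integral_def)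
  also have "\<dots> \<le> (2 * S)\<^sup>2" by (simp add: power2_eq_square)
  finally have "L2_norm g \<le> sqrt ((2 * S)\<^sup>2)" unfolding L2_norm_def by (rule real_sqrt_le_mono)
  also have "\<dots> = 2 * S" using S0 by (intro real_sqrt_unique) auto
  finally show ?thesis .
qed

text \<open>With \<open>L = ln (M/\<delta>) / ln (E/\<epsilon>)\<close> and \<open>n = \<lfloor>L/32\<rfloor>\<close>, the power \<open>(E/\<epsilon>)\<^sup>8\<^sup>n\<^sup>+\<^sup>1\<close> is at most
  \<open>(M/\<delta>)\<^sup>1\<^sup>/\<^sup>2\<close>, and the data term \<open>\<delta> (M/\<delta>)\<^sup>1\<^sup>/\<^sup>2\<close> is negligible against any power of \<open>L\<close>.
  For \<open>L \<ge> 64\<close> the rounding costs at most a factor \<open>2\<close>, so \<open>n \<ge> L/64\<close>, which is where \<open>M = 64 K\<close> comes from.\<close>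

lemma optimal_degree:
  fixes K E c \<epsilon> \<alpha> :: real
  assumes K: "0 < K" and E: "exp 1 \<le> E" and c: "0 < c" and \<epsilon>: "0 < \<epsilon>" "\<epsilon> < 1"
    and \<alpha>: "0 < \<alpha>" "\<alpha> \<le> 1"
  shows "\<exists>\<delta>\<^sub>0>0. \<forall>\<delta>. 0 < \<delta> \<longrightarrow> \<delta> < \<delta>\<^sub>0 \<longrightarrow> (\<exists>n::nat. 1 \<le> n \<and>
    2 * (K * real n powr (- \<alpha>) + \<delta> / c * (E / \<epsilon>) ^ (8 * n + 1))
      \<le> 4 * (64 * K) * (ln (E / \<epsilon>) / ln (64 * K / \<delta>)) powr \<alpha>)"
proof -
  define M where "M = 64 * K"
  define l where "l = ln (E / \<epsilon>)"
  have M: "0 < M" using K by (simp add: M_def)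
  have E\<epsilon>: "E / \<epsilon> \<ge> exp 1"
  proof -
    have "E / \<epsilon> \<ge> E / 1" using \<epsilon> E exp_gt_zero[of "1::real"] by (intro divide_left_mono) linarith+
    then show ?thesis using E by simp
  qed
  have E\<epsilon>1: "E / \<epsilon> \<ge> 1" using E\<epsilon> exp_ge_add_one_self[of "1::real"] by linarith
  have l: "l \<ge> 1" using E\<epsilon> E\<epsilon>1 unfolding l_def by (subst ln_ge_iff) auto
  have ev1: "eventually (\<lambda>\<delta>. 64 * l \<le> ln (M / \<delta>)) (at_right 0)"
    using M by real_asymp
  have ev2: "eventually (\<lambda>\<delta>. ln (M / \<delta>) * (\<delta> / c * (M / \<delta>) powr (1 / 2)) \<le> M) (at_right 0)"
    using M c by real_asymp
  obtain \<delta>\<^sub>0 where \<delta>\<^sub>0: "\<delta>\<^sub>0 > 0"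
    and small: "\<And>\<delta>. 0 < \<delta> \<Longrightarrow> \<delta> < \<delta>\<^sub>0 \<Longrightarrow> 64 * l \<le> ln (M / \<delta>) \<and> ln (M / \<delta>) * (\<delta> / c * (M / \<delta>) powr (1 / 2)) \<le> M"
    using eventually_conj[OF ev1 ev2] unfolding eventually_at_right_field by auto
  show ?thesis
  proof (intro exI[of _ \<delta>\<^sub>0] conjI \<delta>\<^sub>0 allI impI)
    fix \<delta> :: real assume \<delta>: "0 < \<delta>" "\<delta> < \<delta>\<^sub>0"
    define L where "L = ln (M / \<delta>) / l"
    define n where "n = nat \<lfloor>L / 32\<rfloor>"
    have L: "L \<ge> 64" using small[OF \<delta>] l by (simp add: L_def le_divide_eq)
    have n: "real n \<le> L / 32" "L / 32 - 1 < real n"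
      using L of_int_floor_le[of "L / 32"] real_of_int_floor_gt_diff_one[of "L / 32"]
      unfolding n_def by (simp_all add: of_nat_nat)
    have n64: "L / 64 \<le> real n" and n1: "n \<ge> 1" using n L by linarith+
    have lnM: "ln (M / \<delta>) = L * l" using l by (simp add: L_def)
    then have LlnM: "L \<le> ln (M / \<delta>)" using mult_left_mono[OF l, of L] L by simp
    have "L powr - \<alpha> = (ln (E / \<epsilon>) / ln (M / \<delta>)) powr \<alpha>"
    proof -
      have "L powr - \<alpha> = inverse L powr \<alpha>" using L by (simp add: powr_minus inverse_powr)
      then show ?thesis by (simp add: L_def l_def)
    qed
    moreover have "2 * (K * real n powr (- \<alpha>)) \<le> 2 * M * L powr - \<alpha>"
    proof -
      have "real n powr - \<alpha> \<le> (L / 64) powr - \<alpha>"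
        using n64 L \<alpha> by (intro powr_mono2') auto
      also have "\<dots> = 64 powr \<alpha> * L powr - \<alpha>" using L by (simp add: powr_divide powr_minus field_simps)
      also have "\<dots> \<le> 64 * L powr - \<alpha>"
        using powr_mono[of \<alpha> 1 "64 :: real"] \<alpha> by (intro mult_right_mono) auto
      finally show ?thesis using K by (simp add: M_def)
    qed
    moreover have "2 * (\<delta> / c * (E / \<epsilon>) ^ (8 * n + 1)) \<le> 2 * M * L powr - \<alpha>"
    proof -
      define P where "P = (E / \<epsilon>) ^ (8 * n + 1)"
      have P0: "0 \<le> P" unfolding P_def using E\<epsilon>1 by (intro zero_le_power) linarith
      have "P = (E / \<epsilon>) powr (8 * real n + 1)"
        unfolding P_def using E\<epsilon>1 by (subst powr_realpow[symmetric]) (auto simp: algebra_simps)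
      also have "\<dots> \<le> (E / \<epsilon>) powr (L / 2)"
        using n L E\<epsilon>1 by (intro powr_mono) auto
      also have "\<dots> = (M / \<delta>) powr (1 / 2)"
        proof -
        have "E / \<epsilon> \<noteq> 0" "M / \<delta> \<noteq> 0" using E\<epsilon>1 M \<delta> by auto
        then show ?thesis unfolding powr_def using lnM by (simp only: l_def if_False) simp
      qed
      finally have "L * (\<delta> / c * P) \<le> ln (M / \<delta>) * (\<delta> / c * (M / \<delta>) powr (1 / 2))"
        using LlnM L \<delta> c P0 by (intro mult_mono mult_left_mono) auto
      also have "\<dots> \<le> M" using small[OF \<delta>] by simp
      finally have "\<delta> / c * P \<le> M * L powr - 1"
        using L by (simp add: powr_minus field_simps)
      also have "\<dots> \<le> M * L powr - \<alpha>" using M L \<alpha> by (intro mult_left_mono powr_mono) auto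
      finally show ?thesis by (simp add: P_def)
    qed
    ultimately show "\<exists>n::nat. 1 \<le> n \<and>
      2 * (K * real n powr (- \<alpha>) + \<delta> / c * (E / \<epsilon>) ^ (8 * n + 1))
        \<le> 4 * (64 * K) * (ln (E / \<epsilon>) / ln (64 * K / \<delta>)) powr \<alpha>"
      using n1 by (intro exI[of _ n]) (simp add: M_def algebra_simps)
  qed
qed

lemma data_norm_dominates_L1:
  assumes c: "0 < c" and g: "continuous_on UNIV g"
    and dom: "ennreal c * max (\<integral>\<^sup>+p \<in> data_rect \<epsilon> \<gamma>. ennreal (cmod (g p)) \<partial>lborel)
              (\<integral>\<^sup>+\<xi> \<in> {-\<epsilon>..\<epsilon>}. ennreal (cmod (g (\<xi>, \<gamma>))) \<partial>lborel) \<le> ennreal \<delta>"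
    and \<delta>: "0 \<le> \<delta>"
  shows "integral {-\<gamma>..\<gamma>} (\<lambda>\<eta>. integral {-\<epsilon>..\<epsilon>} (\<lambda>\<xi>. cmod (g (\<xi>, \<eta>)))) \<le> \<delta> / c"
    and "integral {-\<epsilon>..\<epsilon>} (\<lambda>\<xi>. cmod (g (\<xi>, \<gamma>))) \<le> \<delta> / c"
proof -
  have *: "r \<le> \<delta> / c" if "ennreal c * ennreal r \<le> ennreal \<delta>" for r
  proof (cases "r \<ge> 0")
    case True
    with that c \<delta> show ?thesis by (simp add: ennreal_mult[symmetric] field_simps)
  next
    case False
    have "0 \<le> \<delta> / c" using c \<delta> by simp
    with False show ?thesis by linarith
  qed
  have top: "(\<integral>\<^sup>+\<xi>\<in>{-\<epsilon>..\<epsilon>}. ennreal (cmod (g (\<xi>, \<gamma>))) \<partial>lborel)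
      = ennreal (integral {-\<epsilon>..\<epsilon>} (\<lambda>\<xi>. cmod (g (\<xi>, \<gamma>))))"
    by (intro nn_integral_Icc_eq_integral continuous_intros continuous_on_compose2[OF g]) auto
  show "integral {-\<gamma>..\<gamma>} (\<lambda>\<eta>. integral {-\<epsilon>..\<epsilon>} (\<lambda>\<xi>. cmod (g (\<xi>, \<eta>)))) \<le> \<delta> / c"
    using order_trans[OF mult_left_mono[OF max.cobounded1] dom]
    unfolding nn_integral_data_rect[OF g] by (intro *) simp
  show "integral {-\<epsilon>..\<epsilon>} (\<lambda>\<xi>. cmod (g (\<xi>, \<gamma>))) \<le> \<delta> / c"
    using order_trans[OF mult_left_mono[OF max.cobounded2] dom]
    unfolding top by (intro *) simp
qed

lemma mean_le_by_radon_data: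
  assumes \<phi>: "mean_kernel \<phi>"
    and holder: "\<And>p q. cmod (f p - f q) \<le> A * norm (p - q) powr \<alpha>"
    and f0: "\<And>x y. y \<le> x\<^sup>2 \<Longrightarrow> f (x, y) = 0"
    and \<alpha>: "0 < \<alpha>" "\<alpha> \<le> 1" and \<epsilon>: "0 < \<epsilon>" "\<epsilon>\<^sup>2 / 4 \<le> \<gamma>" "\<epsilon> + \<gamma> \<le> 1"
    and rect: "integral {-\<gamma>..\<gamma>} (\<lambda>\<eta>. integral {-\<epsilon>..\<epsilon>} (\<lambda>\<xi>. cmod (radon f (\<xi>, \<eta>)))) \<le> d"
    and top: "integral {-\<epsilon>..\<epsilon>} (\<lambda>\<xi>. cmod (radon f (\<xi>, \<gamma>))) \<le> d"
    and n: "1 \<le> n"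
    and \<beta>: "\<And>k t. k \<le> 8 * n \<Longrightarrow> \<bar>(deriv ^^ k) \<phi> t\<bar> \<le> \<beta> k"
    and S: "\<And>k. k \<le> 8 * n \<Longrightarrow> \<beta> k / \<epsilon> ^ Suc k * d * (2 ^ (k - 1) / fact (k - 1)) \<le> S"
    and x: "\<bar>x\<bar> \<le> 1"
  shows "cmod (mean \<phi> \<epsilon> \<gamma> f x) \<le> 516 * A * real n powr (- \<alpha>) + 16 * 7 ^ (4 * n) * S"
proof -
  have f: "continuous_on UNIV f" by (rule holder_imp_continuous[OF holder \<alpha>(1)])
  have \<gamma>: "0 \<le> \<gamma>" using \<epsilon> zero_le_power2[of \<epsilon>] by linarith
  have "cmod (mean \<phi> \<epsilon> \<gamma> f x) \<le> 258 * (2 * A) * real n powr (- \<alpha>) + 16 * 7 ^ (4 * n) * S"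
  proof (rule holder_bound_by_moments[OF _ _ _ \<alpha> n _ x])
    show "continuous_on UNIV (mean \<phi> \<epsilon> \<gamma> f)" by (rule continuous_on_mean[OF \<phi> f \<epsilon>(1)])
    show "mean \<phi> \<epsilon> \<gamma> f x = 0" if "\<bar>x\<bar> > 1" for x
      using mean_eq_0_outside[OF \<phi> f f0 \<epsilon>(1) \<gamma> \<epsilon>(3) that] .
    show "cmod (mean \<phi> \<epsilon> \<gamma> f x - mean \<phi> \<epsilon> \<gamma> f y) \<le> 2 * A * \<bar>x - y\<bar> powr \<alpha>" for x y
      using \<epsilon> \<gamma> by (intro mean_holder[OF \<phi> holder \<alpha>]) auto
    show "cmod (integral {-1..1} (\<lambda>x. x ^ k *\<^sub>R mean \<phi> \<epsilon> \<gamma> f x)) \<le> S" if "k \<le> 8 * n" for k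
      using mean_moment_le[OF \<phi> f f0 \<epsilon> \<beta>[OF that] rect top] S[OF that] by (rule order_trans)
  qed
  then show ?thesis by simp
qed

text \<open>With a fixed kernel there are no uniform bounds for its derivatives, but each derivative is bounded by compactness.
  As the data vanish this already makes all moments zero.\<close>

lemma mean_eq_0_if_radon_data_0:
  assumes \<phi>: "mean_kernel \<phi>"
    and holder: "\<And>p q. cmod (f p - f q) \<le> A * norm (p - q) powr \<alpha>"
    and f0: "\<And>x y. y \<le> x\<^sup>2 \<Longrightarrow> f (x, y) = 0"
    and \<alpha>: "0 < \<alpha>" "\<alpha> \<le> 1" and \<epsilon>: "0 < \<epsilon>" "\<epsilon>\<^sup>2 / 4 \<le> \<gamma>" "\<epsilon> + \<gamma> \<le> 1"
    and rect: "integral {-\<gamma>..\<gamma>} (\<lambda>\<eta>. integral {-\<epsilon>..\<epsilon>} (\<lambda>\<xi>. cmod (radon f (\<xi>, \<eta>)))) \<le> 0"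
    and top: "integral {-\<epsilon>..\<epsilon>} (\<lambda>\<xi>. cmod (radon f (\<xi>, \<gamma>))) \<le> 0"
    and x: "\<bar>x\<bar> \<le> 1"
  shows "mean \<phi> \<epsilon> \<gamma> f x = 0"
proof -
  have "\<exists>b. \<forall>t. \<bar>(deriv ^^ k) \<phi> t\<bar> \<le> b" for k
  proof -
    have "compact ((deriv ^^ k) \<phi> ` {-1..1})"
      by (intro compact_continuous_image mean_kernel_continuous[OF \<phi>] compact_Icc)
    then obtain b where b: "\<And>t. t \<in> {-1..1} \<Longrightarrow> \<bar>(deriv ^^ k) \<phi> t\<bar> \<le> b"
      using compact_imp_bounded bounded_iff by (metis image_eqI real_norm_def)
    have "\<bar>(deriv ^^ k) \<phi> t\<bar> \<le> b" for t
    proof (cases "\<bar>t\<bar> \<ge> 1")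
      case True
      have "0 \<le> b" using b[of 0] by auto
      with True mean_kernelD(2)[OF \<phi>, of t k] show ?thesis by simp
    next
      case False
      then show ?thesis by (intro b) auto
    qed
    then show ?thesis by blast
  qed
  then obtain b where b: "\<And>k t. \<bar>(deriv ^^ k) \<phi> t\<bar> \<le> b k" by metis
  have "cmod (mean \<phi> \<epsilon> \<gamma> f x) \<le> 516 * A * real n powr (- \<alpha>)" if "n \<ge> 1" for n
    using mean_le_by_radon_data[OF \<phi> holder f0 \<alpha> \<epsilon> rect top that b, of 0 x] x by simp
  moreover have "(\<lambda>n. 516 * A * real n powr (- \<alpha>)) \<longlonglongrightarrow> 0"
    using \<alpha>(1) by real_asymp
  ultimately have "cmod (mean \<phi> \<epsilon> \<gamma> f x) \<le> 0"
    by (intro LIMSEQ_le_const[of "\<lambda>n. 516 * A * real n powr (- \<alpha>)"]) auto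
  then show ?thesis by simp
qed

section \<open>Logarithmic stability of the means\<close>

theorem theorem3p6:
  fixes \<phi> :: "nat \<Rightarrow> real \<Rightarrow> real"
    and \<nu> :: "real \<Rightarrow> real \<Rightarrow> (real \<times> real \<Rightarrow> complex) \<Rightarrow> ennreal"
  assumes "test_sequence \<phi>"
    and "data_norm_family \<nu>"
  shows "\<exists>C::real. C \<ge> 1 \<and> (\<forall>C\<^sub>0>0. \<exists>M>0. \<forall>\<alpha> \<epsilon> \<gamma>.
           0 < \<alpha> \<longrightarrow> \<alpha> \<le> 1 \<longrightarrow> 0 < \<epsilon> \<longrightarrow> \<epsilon> < 1 \<longrightarrow> \<epsilon>\<^sup>2 / 4 \<le> \<gamma> \<longrightarrow> \<gamma> < 1 \<longrightarrow> x_sol \<epsilon> \<gamma> \<le> 1 \<longrightarrow>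
           (\<exists>\<delta>\<^sub>0::real. \<delta>\<^sub>0 > 0 \<and> (\<forall>f :: real \<times> real \<Rightarrow> complex.
              holder_seminorm \<alpha> f \<le> ereal C\<^sub>0 \<longrightarrow>
              supp f \<subseteq> {(x, y). y \<ge> x\<^sup>2} \<longrightarrow>
              \<nu> \<epsilon> \<gamma> (radon f) < ennreal \<delta>\<^sub>0 \<longrightarrow>
              (\<exists>N\<ge>1. L2_norm (mean (\<phi> N) \<epsilon> \<gamma> f) \<le>
                 (let \<delta> = enn2real (\<nu> \<epsilon> \<gamma> (radon f))
                  in if \<delta> = 0 then 0
                     else 4 * M * (ln (C / \<epsilon>) / ln (M / \<delta>)) powr \<alpha>)))))"
proof -
  have ker: "mean_kernel (\<phi> N)" if "N \<ge> 1" for N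
    using assms(1) that by (simp add: test_sequence_def)
  obtain Cs where Cs: "\<And>N k t. N \<ge> 1 \<Longrightarrow> k \<le> N \<Longrightarrow> \<bar>(deriv ^^ k) (\<phi> N) t\<bar> \<le> Cs ^ (k + 1) * real N ^ k"
    using assms(1) unfolding test_sequence_def by blast
  define B where "B = max 1 \<bar>Cs\<bar>"
  have B: "1 \<le> B" by (simp add: B_def)
  have der: "\<bar>(deriv ^^ k) (\<phi> N) t\<bar> \<le> B ^ (k + 1) * real N ^ k" if "N \<ge> 1" "k \<le> N" for N k t
  proof -
    have "Cs ^ (k + 1) \<le> \<bar>Cs\<bar> ^ (k + 1)" by (metis abs_ge_self power_abs)
    also have "\<dots> \<le> B ^ (k + 1)" by (intro power_mono) (auto simp: B_def)
    finally have "Cs ^ (k + 1) * real N ^ k \<le> B ^ (k + 1) * real N ^ k" by (intro mult_right_mono) auto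
    then show ?thesis using Cs[OF that, of t] by linarith
  qed
  obtain c where c: "0 < c" and dom: "\<And>\<epsilon> \<gamma> g. 0 < \<epsilon> \<Longrightarrow> \<epsilon> < 1 \<Longrightarrow> 0 < \<gamma> \<Longrightarrow> \<gamma> < 1 \<Longrightarrow> continuous_on UNIV g \<Longrightarrow>
        ennreal c * max (\<integral>\<^sup>+p \<in> data_rect \<epsilon> \<gamma>. ennreal (cmod (g p)) \<partial>lborel)
              (\<integral>\<^sup>+\<xi> \<in> {-\<epsilon>..\<epsilon>}. ennreal (cmod (g (\<xi>, \<gamma>))) \<partial>lborel) \<le> \<nu> \<epsilon> \<gamma> g"
    using assms(2) unfolding data_norm_family_def by blast
  \<comment> \<open>\<open>B exp 3 / \<epsilon>\<close> is the growth rate of the moment bounds.  The factor \<open>112 = 16 \<cdot> 7\<close> absorbs the coefficients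
    \<open>16 \<cdot> 7\<^sup>4\<^sup>n\<close> of the Jackson kernel into the power \<open>8n + 1\<close>.\<close>
  define E where "E = 112 * (B * exp 3)"
  have E: "exp 1 \<le> E"
  proof -
    have "1 * exp (1::real) \<le> B * exp 3" using B by (intro mult_mono) auto
    also have "\<dots> \<le> E" using B by (simp add: E_def)
    finally show ?thesis by simp
  qed
  show ?thesis
  proof (rule exI[of _ E], intro conjI allI impI)
    show "1 \<le> E" using E exp_ge_add_one_self[of "1::real"] by linarith
    fix C\<^sub>0 :: real assume C\<^sub>0: "0 < C\<^sub>0"
    define K where "K = 516 * C\<^sub>0"
    have K: "0 < K" using C\<^sub>0 by (simp add: K_def)
    show "\<exists>M>0. \<forall>\<alpha> \<epsilon> \<gamma>.
           0 < \<alpha> \<longrightarrow> \<alpha> \<le> 1 \<longrightarrow> 0 < \<epsilon> \<longrightarrow> \<epsilon> < 1 \<longrightarrow> \<epsilon>\<^sup>2 / 4 \<le> \<gamma> \<longrightarrow> \<gamma> < 1 \<longrightarrow> x_sol \<epsilon> \<gamma> \<le> 1 \<longrightarrow>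
           (\<exists>\<delta>\<^sub>0::real. \<delta>\<^sub>0 > 0 \<and> (\<forall>f :: real \<times> real \<Rightarrow> complex.
              holder_seminorm \<alpha> f \<le> ereal C\<^sub>0 \<longrightarrow>
              supp f \<subseteq> {(x, y). y \<ge> x\<^sup>2} \<longrightarrow>
              \<nu> \<epsilon> \<gamma> (radon f) < ennreal \<delta>\<^sub>0 \<longrightarrow>
              (\<exists>N\<ge>1. L2_norm (mean (\<phi> N) \<epsilon> \<gamma> f) \<le>
                 (let \<delta> = enn2real (\<nu> \<epsilon> \<gamma> (radon f))
                  in if \<delta> = 0 then 0
                     else 4 * M * (ln (E / \<epsilon>) / ln (M / \<delta>)) powr \<alpha>))))"
    proof (rule exI[of _ "64 * K"], intro conjI allI impI)
      show "0 < 64 * K" using K by simp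
      fix \<alpha> \<epsilon> \<gamma> :: real
      assume \<alpha>: "0 < \<alpha>" "\<alpha> \<le> 1" and \<epsilon>: "0 < \<epsilon>" "\<epsilon> < 1" and \<epsilon>\<gamma>: "\<epsilon>\<^sup>2 / 4 \<le> \<gamma>" and \<gamma>1: "\<gamma> < 1"
        and xs: "x_sol \<epsilon> \<gamma> \<le> 1"
      have "0 < \<epsilon>\<^sup>2" using \<epsilon> by simp
      then have \<gamma>: "0 < \<gamma>" using \<epsilon>\<gamma> by linarith
      have sum1: "\<epsilon> + \<gamma> \<le> 1" by (rule x_sol_le_1D[OF \<epsilon>(1) \<gamma> xs])
      obtain \<delta>\<^sub>0 where \<delta>\<^sub>0: "0 < \<delta>\<^sub>0" and opt: "\<And>\<delta>. 0 < \<delta> \<Longrightarrow> \<delta> < \<delta>\<^sub>0 \<Longrightarrow> \<exists>n::nat. 1 \<le> n \<and>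
          2 * (K * real n powr (- \<alpha>) + \<delta> / c * (E / \<epsilon>) ^ (8 * n + 1))
            \<le> 4 * (64 * K) * (ln (E / \<epsilon>) / ln (64 * K / \<delta>)) powr \<alpha>"
        using optimal_degree[OF K E c \<epsilon> \<alpha>] by blast
      show "\<exists>\<delta>\<^sub>0::real. \<delta>\<^sub>0 > 0 \<and> (\<forall>f :: real \<times> real \<Rightarrow> complex.
              holder_seminorm \<alpha> f \<le> ereal C\<^sub>0 \<longrightarrow>
              supp f \<subseteq> {(x, y). y \<ge> x\<^sup>2} \<longrightarrow>
              \<nu> \<epsilon> \<gamma> (radon f) < ennreal \<delta>\<^sub>0 \<longrightarrow>
              (\<exists>N\<ge>1. L2_norm (mean (\<phi> N) \<epsilon> \<gamma> f) \<le>
                 (let \<delta> = enn2real (\<nu> \<epsilon> \<gamma> (radon f))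
                  in if \<delta> = 0 then 0
                     else 4 * (64 * K) * (ln (E / \<epsilon>) / ln (64 * K / \<delta>)) powr \<alpha>)))"
      proof (rule exI[of _ \<delta>\<^sub>0], intro conjI \<delta>\<^sub>0 allI impI)
        fix f :: "real \<times> real \<Rightarrow> complex"
        assume sn: "holder_seminorm \<alpha> f \<le> ereal C\<^sub>0" and supp: "supp f \<subseteq> {(x, y). y \<ge> x\<^sup>2}"
          and small: "\<nu> \<epsilon> \<gamma> (radon f) < ennreal \<delta>\<^sub>0"
        note holder = holder_seminorm_bound[OF sn]
        have f: "continuous_on UNIV f" by (rule holder_imp_continuous[OF holder \<alpha>(1)])
        note f0 = vanishes_below_parabola[OF f supp]
        note cR = continuous_on_radon[OF f f0]
        define \<delta> where "\<delta> = enn2real (\<nu> \<epsilon> \<gamma> (radon f))"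
        have fin: "\<nu> \<epsilon> \<gamma> (radon f) < top" using small by (rule less_trans) simp
        then have \<nu>: "\<nu> \<epsilon> \<gamma> (radon f) = ennreal \<delta>" by (simp add: \<delta>_def)
        have \<delta>0: "0 \<le> \<delta>" by (simp add: \<delta>_def)
        have \<delta>\<delta>\<^sub>0: "\<delta> < \<delta>\<^sub>0" using small \<delta>0 unfolding \<nu> by (simp add: ennreal_less_iff)
        note L1 = data_norm_dominates_L1[OF c cR dom[OF \<epsilon> \<gamma> \<gamma>1 cR, unfolded \<nu>] \<delta>0]
        have "\<exists>N\<ge>1. L2_norm (mean (\<phi> N) \<epsilon> \<gamma> f) \<le>
            (if \<delta> = 0 then 0 else 4 * (64 * K) * (ln (E / \<epsilon>) / ln (64 * K / \<delta>)) powr \<alpha>)"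
        proof (cases "\<delta> = 0")
          case True
          have "L2_norm (mean (\<phi> 1) \<epsilon> \<gamma> f) \<le> 2 * 0"
            using mean_eq_0_if_radon_data_0[OF ker holder f0 \<alpha> \<epsilon>(1) \<epsilon>\<gamma> sum1] L1 True
            by (intro L2_norm_le) simp
          then show ?thesis using True by (intro exI[of _ 1]) simp
        next
          case False
          then obtain n :: nat where n: "1 \<le> n" and n_opt: "2 * (K * real n powr (- \<alpha>) + \<delta> / c * (E / \<epsilon>) ^ (8 * n + 1))
            \<le> 4 * (64 * K) * (ln (E / \<epsilon>) / ln (64 * K / \<delta>)) powr \<alpha>"
            using opt[of \<delta>] \<delta>0 \<delta>\<delta>\<^sub>0 by auto
          define S where "S = \<delta> / c * (B * exp 3 / \<epsilon>) ^ (8 * n + 1)"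
          have d0: "0 \<le> \<delta> / c" using \<delta>0 c by simp
          have "cmod (mean (\<phi> (8 * n)) \<epsilon> \<gamma> f x) \<le> K * real n powr (- \<alpha>) + \<delta> / c * (E / \<epsilon>) ^ (8 * n + 1)"
            if x: "\<bar>x\<bar> \<le> 1" for x
          proof -
            have "cmod (mean (\<phi> (8 * n)) \<epsilon> \<gamma> f x) \<le> 516 * C\<^sub>0 * real n powr (- \<alpha>) + 16 * 7 ^ (4 * n) * S"
            proof (rule mean_le_by_radon_data[OF ker holder f0 \<alpha> \<epsilon>(1) \<epsilon>\<gamma> sum1 L1 n _ _ x])
              show "\<bar>(deriv ^^ k) (\<phi> (8 * n)) t\<bar> \<le> B ^ (k + 1) * real (8 * n) ^ k" if "k \<le> 8 * n" for k t
                using n that by (intro der) auto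
              show "B ^ (k + 1) * real (8 * n) ^ k / \<epsilon> ^ Suc k * (\<delta> / c) * (2 ^ (k - 1) / fact (k - 1)) \<le> S"
                if "k \<le> 8 * n" for k
                using mult_left_mono[OF moment_growth[OF B \<epsilon> that] d0] n
                by (simp add: S_def mult_ac)
            qed (use n in auto)
            also have "16 * 7 ^ (4 * n) * S \<le> \<delta> / c * (E / \<epsilon>) ^ (8 * n + 1)"
            proof -
              have "(16::real) * 7 ^ (4 * n) \<le> 16 ^ (8 * n + 1) * 7 ^ (8 * n + 1)"
                using power_increasing[of 1 "8 * n + 1" "16::real"]
                by (intro mult_mono power_increasing) auto
              also have "\<dots> = 112 ^ (8 * n + 1)" by (subst power_mult_distrib[symmetric]) simp
              finally have "(16::real) * 7 ^ (4 * n) \<le> 112 ^ (8 * n + 1)" .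
              moreover have "0 \<le> S"
                unfolding S_def using B \<epsilon> by (intro mult_nonneg_nonneg d0 zero_le_power) auto
              ultimately have "16 * 7 ^ (4 * n) * S \<le> 112 ^ (8 * n + 1) * S"
                by (rule mult_right_mono)
              also have "\<dots> = \<delta> / c * (112 * (B * exp 3 / \<epsilon>)) ^ (8 * n + 1)"
                unfolding S_def power_mult_distrib[of 112] by (simp only: mult_ac)
              finally show ?thesis by (simp add: E_def)
            qed
            finally show ?thesis by (simp add: K_def)
          qed
          then have "L2_norm (mean (\<phi> (8 * n)) \<epsilon> \<gamma> f)
              \<le> 2 * (K * real n powr (- \<alpha>) + \<delta> / c * (E / \<epsilon>) ^ (8 * n + 1))"
            by (rule L2_norm_le)
          with n_opt False n show ?thesis by (intro exI[of _ "8 * n"]) auto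
        qed
        then show "\<exists>N\<ge>1. L2_norm (mean (\<phi> N) \<epsilon> \<gamma> f) \<le>
                 (let \<delta> = enn2real (\<nu> \<epsilon> \<gamma> (radon f))
                  in if \<delta> = 0 then 0
                     else 4 * (64 * K) * (ln (E / \<epsilon>) / ln (64 * K / \<delta>)) powr \<alpha>)"
          unfolding \<delta>_def[symmetric] Let_def .
      qed
    qed
  qed
qed

end
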